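(* Let $(M,g)$ be a smooth $n$-dimensional Riemannian manifold of constant sectional curvature $c$. Let $A$ be a real constant and $\lambda:[0,\infty)\to\mathbb{R}$ a smooth function satisfying $$A>0,\qquad \lambda(t)>0,\qquad A^2-2ct\lambda(t)^2>0,\qquad \lambda(t)+2t\lambda'(t)>0\qquad\text{for all } t\ge 0.$$ Consider the class of K\"ahler structures $(G,J)$ on $T^*M$, depending on the parameter $\lambda$, defined by $$J\frac{\delta}{\delta q^i}=J^{(1)}_{ij}\frac{\partial}{\partial p_j},\qquad J\frac{\partial}{\partial p_i}=-J_{(2)}^{ij}\frac{\delta}{\delta q^j},$$ $$J^{(1)}_{ij}=\frac{A}{\lambda}g_{ij}-\frac{c\lambda^3+A^2\lambda'}{A\lambda(\lambda+2t\lambda')}p_ip_j,\qquad J_{(2)}^{ij}=\frac{\lambda}{A}g^{ij}+\frac{c\lambda^3+A^2\lambda'}{A(A^2-2ct\lambda^2)}g^{0i}g^{0j},$$ $$G\Big(\frac{\delta}{\delta q^i},\frac{\delta}{\delta q^j}\Big)=Ag_{ij}-\frac{c\lambda^2}{A}p_ip_j,\qquad G\Big(\frac{\partial}{\partial p_i},\frac{\partial}{\partial p_j}\Big)=\frac{\lambda^2}{A}g^{ij}+\frac{c\lambda^4+2A^2\lambda'(\lambda+t\lambda')}{A(A^2-2ct\lambda^2)}g^{0i}g^{0j},\qquad G\Big(\frac{\partial}{\partial p_i},\frac{\delta}{\delta q^j}\Big)=0.$$ Then the class of K\"ahler structures $(G,J)$ on $T^*M$ cannot have constant holomorphic sectional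 curvature.
   Context: Let $\pi:T^*M\to M$ be the cotangent bundle of $M$. A local chart $(U,x^1,\dots,x^n)$ on $M$ induces the local chart $(\pi^{-1}(U),q^1,\dots,q^n,p_1,\dots,p_n)$ on $T^*M$ with $q^i=x^i\circ\pi$ and $p=p_i\,dx^i_{\pi(p)}$. The summation convention is used and all indices run over $1,\dots,n$. $g_{ij}$ are the components of $g$, $(g^{ij})$ is the inverse matrix (both evaluated at $\pi(p)$), and $g^{0i}=p_hg^{hi}$. With $\Gamma^k_{ih}$ the Christoffel symbols of $g$, put $\frac{\delta}{\delta q^i}=\frac{\partial}{\partial q^i}+p_k\Gamma^k_{ih}\frac{\partial}{\partial p_h}$; the fields $\frac{\delta}{\delta q^1},\dots,\frac{\delta}{\delta q^n},\frac{\partial}{\partial p_1},\dots,\frac{\partial}{\partial p_n}$ form a local frame on $T^*M$ (the adapted local frame). The energy density is $t=\frac12 g^{ik}(\pi(p))p_ip_k\in[0,\infty)$; functions of $t$ such as $\lambda$ and $\lambda'=d\lambda/dt$ are viewed as functions on $T^*M$ by evaluating them at the energy density.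
   Formalization: Assumes M is nonempty with n ≥ 2 (for n = 1, G always has constant curvature c/A); for c = 0 only nonzero constant holomorphic sectional curvature is excluded, since then G is flat for every admissible λ. *)

theory Defs
  imports "HOL-Analysis.Analysis"
begin

section \<open>Smooth maps\<close>

text \<open>Only used for open sets S and for the half-line S = {0..} (one-sided derivatives at 0);
  in both cases the derivative within S is unique.\<close>

fun C_k_on :: "nat \<Rightarrow> 'a::real_normed_vector set \<Rightarrow> ('a \<Rightarrow> 'b::real_normed_vector) \<Rightarrow> bool" where
  "C_k_on 0 S f \<longleftrightarrow> continuous_on S f"
| "C_k_on (Suc k) S f \<longleftrightarrow>
     f differentiable_on S \<and> (\<forall>v. C_k_on k S (\<lambda>x. frechet_derivative f (at x within S) v))"

definition smooth_on :: "'a::real_normed_vector set \<Rightarrow> ('a \<Rightarrow> 'b::real_normed_vector) \<Rightarrow> bool" where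
  "smooth_on S f \<longleftrightarrow> (\<forall>k. C_k_on k S f)"


section \<open>Smooth manifolds and tensor fields\<close>

text \<open>A chart is a pair of its domain and its coordinate map.\<close>

type_synonym ('a, 'e) chart = "'a set \<times> ('a \<Rightarrow> 'e)"

definition coord_image :: "('a, 'e) chart \<Rightarrow> 'e set" where
  "coord_image \<kappa> = snd \<kappa> ` fst \<kappa>"

definition transition :: "('a, 'e) chart \<Rightarrow> ('a, 'e) chart \<Rightarrow> 'e \<Rightarrow> 'e" where
  "transition \<kappa> \<kappa>' = snd \<kappa>' \<circ> inv_into (fst \<kappa>) (snd \<kappa>)"

definition transition_deriv ::
    "('a, 'e::euclidean_space) chart \<Rightarrow> ('a, 'e) chart \<Rightarrow> 'a \<Rightarrow> 'e \<Rightarrow> 'e" where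
  "transition_deriv \<kappa> \<kappa>' x = frechet_derivative (transition \<kappa> \<kappa>') (at (snd \<kappa> x))"

definition smooth_manifold :: "'a topology \<Rightarrow> ('a, 'e::euclidean_space) chart set \<Rightarrow> bool" where
  "smooth_manifold M atl \<longleftrightarrow>
     Hausdorff_space M \<and> second_countable M \<and> topspace M = (\<Union>\<kappa>\<in>atl. fst \<kappa>) \<and>
     (\<forall>\<kappa>\<in>atl. openin M (fst \<kappa>) \<and> open (coord_image \<kappa>) \<and>
        homeomorphic_map (subtopology M (fst \<kappa>)) (top_of_set (coord_image \<kappa>)) (snd \<kappa>)) \<and>
     (\<forall>\<kappa>\<in>atl. \<forall>\<kappa>'\<in>atl. smooth_on (snd \<kappa> ` (fst \<kappa> \<inter> fst \<kappa>')) (transition \<kappa> \<kappa>'))"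

text \<open>A tensor field is given by its local expression in each chart of the atlas (a function of the
  coordinates of the point and of the coordinates of the tangent vectors), subject to the
  usual transformation law on overlaps.\<close>

type_synonym ('a, 'e) metric_field = "('a, 'e) chart \<Rightarrow> 'e \<Rightarrow> 'e \<Rightarrow> 'e \<Rightarrow> real"
type_synonym ('a, 'e) endo_field = "('a, 'e) chart \<Rightarrow> 'e \<Rightarrow> 'e \<Rightarrow> 'e"

definition riemannian_metric ::
    "('a, 'e::euclidean_space) chart set \<Rightarrow> ('a, 'e) metric_field \<Rightarrow> bool" where
  "riemannian_metric atl g \<longleftrightarrow>
     (\<forall>\<kappa>\<in>atl. (\<forall>v w. smooth_on (coord_image \<kappa>) (\<lambda>u. g \<kappa> u v w)) \<and>
        (\<forall>u\<in>coord_image \<kappa>. bilinear (g \<kappa> u) \<and> (\<forall>v w. g \<kappa> u v w = g \<kappa> u w v) \<and>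
           (\<forall>v. v \<noteq> 0 \<longrightarrow> g \<kappa> u v v > 0))) \<and>
     (\<forall>\<kappa>\<in>atl. \<forall>\<kappa>'\<in>atl. \<forall>x\<in>fst \<kappa> \<inter> fst \<kappa>'. \<forall>v w.
        g \<kappa> (snd \<kappa> x) v w =
        g \<kappa>' (snd \<kappa>' x) (transition_deriv \<kappa> \<kappa>' x v) (transition_deriv \<kappa> \<kappa>' x w))"

definition almost_complex_structure ::
    "('a, 'e::euclidean_space) chart set \<Rightarrow> ('a, 'e) endo_field \<Rightarrow> bool" where
  "almost_complex_structure atl J \<longleftrightarrow>
     (\<forall>\<kappa>\<in>atl. (\<forall>v. smooth_on (coord_image \<kappa>) (\<lambda>u. J \<kappa> u v)) \<and>
        (\<forall>u\<in>coord_image \<kappa>. linear (J \<kappa> u) \<and> (\<forall>v. J \<kappa> u (J \<kappa> u v) = - v))) \<and>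
     (\<forall>\<kappa>\<in>atl. \<forall>\<kappa>'\<in>atl. \<forall>x\<in>fst \<kappa> \<inter> fst \<kappa>'. \<forall>v.
        transition_deriv \<kappa> \<kappa>' x (J \<kappa> (snd \<kappa> x) v) =
        J \<kappa>' (snd \<kappa>' x) (transition_deriv \<kappa> \<kappa>' x v))"


section \<open>Curvature in local coordinates\<close>

text \<open>In this section a metric, an endomorphism field etc. are local expressions in one chart, and
  X, Y, Z are vectors, identified with the vector fields having constant components (so that
  their Lie brackets vanish).\<close>

definition dir_deriv ::
    "('e::euclidean_space \<Rightarrow> 'b::real_normed_vector) \<Rightarrow> 'e \<Rightarrow> 'e \<Rightarrow> 'b" where
  "dir_deriv f u v = frechet_derivative f (at u) v"

text \<open>The covariant derivative of Y along X, characterized by the Koszul formula.\<close>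

definition levi_civita :: "('e::euclidean_space \<Rightarrow> 'e \<Rightarrow> 'e \<Rightarrow> real) \<Rightarrow> 'e \<Rightarrow> 'e \<Rightarrow> 'e \<Rightarrow> 'e" where
  "levi_civita g u X Y = (THE W. \<forall>Z. 2 * g u W Z =
     dir_deriv (\<lambda>u. g u Y Z) u X + dir_deriv (\<lambda>u. g u X Z) u Y - dir_deriv (\<lambda>u. g u X Y) u Z)"

text \<open>R(X,Y)Z, the difference of the second covariant derivatives of Z along X, Y and along Y, X.\<close>

definition curvature ::
    "('e::euclidean_space \<Rightarrow> 'e \<Rightarrow> 'e \<Rightarrow> real) \<Rightarrow> 'e \<Rightarrow> 'e \<Rightarrow> 'e \<Rightarrow> 'e \<Rightarrow> 'e" where
  "curvature g u X Y Z =
     dir_deriv (\<lambda>u. levi_civita g u Y Z) u X + levi_civita g u X (levi_civita g u Y Z)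
     - dir_deriv (\<lambda>u. levi_civita g u X Z) u Y - levi_civita g u Y (levi_civita g u X Z)"

definition sectional_curvature ::
    "('e::euclidean_space \<Rightarrow> 'e \<Rightarrow> 'e \<Rightarrow> real) \<Rightarrow> 'e \<Rightarrow> 'e \<Rightarrow> 'e \<Rightarrow> real" where
  "sectional_curvature g u X Y =
     g u (curvature g u X Y Y) X / (g u X X * g u Y Y - (g u X Y)\<^sup>2)"

definition constant_sectional_curvature ::
    "('a, 'e::euclidean_space) chart set \<Rightarrow> ('a, 'e) metric_field \<Rightarrow> real \<Rightarrow> bool" where
  "constant_sectional_curvature atl g c \<longleftrightarrow>
     (\<forall>\<kappa>\<in>atl. \<forall>u\<in>coord_image \<kappa>. \<forall>X Y. X \<noteq> Y \<and> independent {X, Y} \<longrightarrow>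
        sectional_curvature (g \<kappa>) u X Y = c)"

definition constant_holomorphic_sectional_curvature ::
    "('a, 'e::euclidean_space) chart set \<Rightarrow> ('a, 'e) metric_field \<Rightarrow> ('a, 'e) endo_field
      \<Rightarrow> real \<Rightarrow> bool" where
  "constant_holomorphic_sectional_curvature atl G J k \<longleftrightarrow>
     (\<forall>\<kappa>\<in>atl. \<forall>u\<in>coord_image \<kappa>. \<forall>X. X \<noteq> 0 \<longrightarrow>
        sectional_curvature (G \<kappa>) u X (J \<kappa> u X) = k)"


section \<open>Kaehler structures\<close>

definition nijenhuis :: "('e::euclidean_space \<Rightarrow> 'e \<Rightarrow> 'e) \<Rightarrow> 'e \<Rightarrow> 'e \<Rightarrow> 'e \<Rightarrow> 'e" where
  "nijenhuis J u X Y =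
     dir_deriv (\<lambda>u. J u Y) u (J u X) - dir_deriv (\<lambda>u. J u X) u (J u Y)
     - J u (dir_deriv (\<lambda>u. J u Y) u X - dir_deriv (\<lambda>u. J u X) u Y)"

definition fundamental_form ::
    "('e::euclidean_space \<Rightarrow> 'e \<Rightarrow> 'e \<Rightarrow> real) \<Rightarrow> ('e \<Rightarrow> 'e \<Rightarrow> 'e) \<Rightarrow> 'e \<Rightarrow> 'e \<Rightarrow> 'e \<Rightarrow> real" where
  "fundamental_form G J u X Y = G u X (J u Y)"

definition closed_2form :: "('e::euclidean_space \<Rightarrow> 'e \<Rightarrow> 'e \<Rightarrow> real) \<Rightarrow> 'e set \<Rightarrow> bool" where
  "closed_2form \<omega> S \<longleftrightarrow> (\<forall>u\<in>S. \<forall>X Y Z.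
     dir_deriv (\<lambda>u. \<omega> u Y Z) u X + dir_deriv (\<lambda>u. \<omega> u Z X) u Y
     + dir_deriv (\<lambda>u. \<omega> u X Y) u Z = 0)"

definition kaehler_structure ::
    "('a, 'e::euclidean_space) chart set \<Rightarrow> ('a, 'e) metric_field \<Rightarrow> ('a, 'e) endo_field \<Rightarrow> bool" where
  "kaehler_structure atl G J \<longleftrightarrow>
     riemannian_metric atl G \<and> almost_complex_structure atl J \<and>
     (\<forall>\<kappa>\<in>atl. (\<forall>u\<in>coord_image \<kappa>. \<forall>X Y. G \<kappa> u (J \<kappa> u X) (J \<kappa> u Y) = G \<kappa> u X Y) \<and>
        (\<forall>u\<in>coord_image \<kappa>. \<forall>X Y. nijenhuis (J \<kappa>) u X Y = 0) \<and>
        closed_2form (fundamental_form (G \<kappa>) (J \<kappa>)) (coord_image \<kappa>))"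


section \<open>The cotangent bundle\<close>

text \<open>A covector at x is the family of its component vectors in all charts around x; it is set
  to 0 on everything that is not a chart around x, so that covectors are determined by their
  components.\<close>

type_synonym ('a, 'e) covector = "('a, 'e) chart \<Rightarrow> 'e"

definition cotangent_space ::
    "('a, 'e::euclidean_space) chart set \<Rightarrow> 'a \<Rightarrow> ('a, 'e) covector set" where
  "cotangent_space atl x = {\<xi>.
     (\<forall>\<kappa>\<in>atl. \<forall>\<kappa>'\<in>atl. x \<in> fst \<kappa> \<inter> fst \<kappa>' \<longrightarrow>
        (\<forall>v. \<xi> \<kappa> \<bullet> v = \<xi> \<kappa>' \<bullet> transition_deriv \<kappa> \<kappa>' x v)) \<and>
     (\<forall>\<kappa>. \<not> (\<kappa> \<in> atl \<and> x \<in> fst \<kappa>) \<longrightarrow> \<xi> \<kappa> = 0)}"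

definition cotangent_chart ::
    "('a, 'e::euclidean_space) chart set \<Rightarrow> ('a, 'e) chart \<Rightarrow> ('a \<times> ('a, 'e) covector, 'e \<times> 'e) chart"
  where
  "cotangent_chart atl \<kappa> = (Sigma (fst \<kappa>) (cotangent_space atl), \<lambda>(x, \<xi>). (snd \<kappa> x, \<xi> \<kappa>))"

definition cotangent_atlas ::
    "('a, 'e::euclidean_space) chart set \<Rightarrow> ('a \<times> ('a, 'e) covector, 'e \<times> 'e) chart set" where
  "cotangent_atlas atl = cotangent_chart atl ` atl"


section \<open>Component functions on the cotangent bundle\<close>

text \<open>Here g is the local expression of the metric of the base in one chart, and (q, p) are the
  induced coordinates on the cotangent bundle.\<close>

type_synonym 'n local_metric = "(real ^ 'n) \<Rightarrow> (real ^ 'n) \<Rightarrow> (real ^ 'n) \<Rightarrow> real"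

definition lower :: "'n::finite local_metric \<Rightarrow> real ^ 'n \<Rightarrow> 'n \<Rightarrow> 'n \<Rightarrow> real" where
  "lower g q i j = g q (axis i 1) (axis j 1)"

definition upper :: "'n::finite local_metric \<Rightarrow> real ^ 'n \<Rightarrow> 'n \<Rightarrow> 'n \<Rightarrow> real" where
  "upper g q i j = matrix_inv (\<chi> k l. lower g q k l) $ i $ j"

text \<open>\<open>christoffel g q k i h\<close> has upper index k and lower indices i, h.\<close>

definition christoffel :: "'n::finite local_metric \<Rightarrow> real ^ 'n \<Rightarrow> 'n \<Rightarrow> 'n \<Rightarrow> 'n \<Rightarrow> real" where
  "christoffel g q k i h = levi_civita g q (axis i 1) (axis h 1) $ k"

definition delta_q ::
    "'n::finite local_metric \<Rightarrow> real ^ 'n \<Rightarrow> real ^ 'n \<Rightarrow> 'n \<Rightarrow> (real ^ 'n) \<times> (real ^ 'n)" where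
  "delta_q g q p i = (axis i 1, \<chi> h. \<Sum>k\<in>UNIV. p $ k * christoffel g q k i h)"

definition partial_p :: "'n::finite \<Rightarrow> (real ^ 'n) \<times> (real ^ 'n)" where
  "partial_p i = (0, axis i 1)"

definition energy :: "'n::finite local_metric \<Rightarrow> real ^ 'n \<Rightarrow> real ^ 'n \<Rightarrow> real" where
  "energy g q p = (1 / 2) * (\<Sum>i\<in>UNIV. \<Sum>k\<in>UNIV. upper g q i k * p $ i * p $ k)"

definition g0 :: "'n::finite local_metric \<Rightarrow> real ^ 'n \<Rightarrow> real ^ 'n \<Rightarrow> 'n \<Rightarrow> real" where
  "g0 g q p i = (\<Sum>h\<in>UNIV. p $ h * upper g q h i)"

definition half_line_deriv :: "(real \<Rightarrow> real) \<Rightarrow> real \<Rightarrow> real" where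
  "half_line_deriv f t = vector_derivative f (at t within {0..})"

definition J1 :: "real \<Rightarrow> real \<Rightarrow> (real \<Rightarrow> real) \<Rightarrow> 'n::finite local_metric
    \<Rightarrow> real ^ 'n \<Rightarrow> real ^ 'n \<Rightarrow> 'n \<Rightarrow> 'n \<Rightarrow> real" where
  "J1 A c lam g q p i j =
     (let t = energy g q p; l = lam t; l' = half_line_deriv lam t in
        A / l * lower g q i j
        - (c * l ^ 3 + A\<^sup>2 * l') / (A * l * (l + 2 * t * l')) * p $ i * p $ j)"

definition J2 :: "real \<Rightarrow> real \<Rightarrow> (real \<Rightarrow> real) \<Rightarrow> 'n::finite local_metric
    \<Rightarrow> real ^ 'n \<Rightarrow> real ^ 'n \<Rightarrow> 'n \<Rightarrow> 'n \<Rightarrow> real" where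
  "J2 A c lam g q p i j =
     (let t = energy g q p; l = lam t; l' = half_line_deriv lam t in
        l / A * upper g q i j
        + (c * l ^ 3 + A\<^sup>2 * l') / (A * (A\<^sup>2 - 2 * c * t * l\<^sup>2)) * g0 g q p i * g0 g q p j)"

definition G_qq :: "real \<Rightarrow> real \<Rightarrow> (real \<Rightarrow> real) \<Rightarrow> 'n::finite local_metric
    \<Rightarrow> real ^ 'n \<Rightarrow> real ^ 'n \<Rightarrow> 'n \<Rightarrow> 'n \<Rightarrow> real" where
  "G_qq A c lam g q p i j =
     (let l = lam (energy g q p) in A * lower g q i j - c * l\<^sup>2 / A * p $ i * p $ j)"

definition G_pp :: "real \<Rightarrow> real \<Rightarrow> (real \<Rightarrow> real) \<Rightarrow> 'n::finite local_metric
    \<Rightarrow> real ^ 'n \<Rightarrow> real ^ 'n \<Rightarrow> 'n \<Rightarrow> 'n \<Rightarrow> real" where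
  "G_pp A c lam g q p i j =
     (let t = energy g q p; l = lam t; l' = half_line_deriv lam t in
        l\<^sup>2 / A * upper g q i j
        + (c * l ^ 4 + 2 * A\<^sup>2 * l' * (l + t * l')) / (A * (A\<^sup>2 - 2 * c * t * l\<^sup>2))
          * g0 g q p i * g0 g q p j)"

end

theory Submission
  imports Defs
begin

text \<open>The obstruction already sits on the zero section \<open>p = 0\<close> of the cotangent bundle.  Write
\<open>e = (a, 0)\<close> for a coordinate vector tangent to the zero section, \<open>f = (0, b)\<close> for a vertical one,
and \<open>R(x, y, z, w) = G(R(x, y)z, w)\<close>.  On the zero section \<open>G\<close> is block diagonal and its diagonal
blocks are even in \<open>p\<close>; all contributions of the Christoffel symbols of \<open>g\<close> cancel because the
dual metric is parallel, and what is left is the quadratic term \<open>- (c \<lambda>\<^sup>2 / A) p\<^sub>i p\<^sub>j\<close> of the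
horizontal block.  This gives \<open>R(e, f, f, e) = (c \<lambda>(0)\<^sup>2 / A) (b \<bullet> a)\<^sup>2\<close> (lemma \<open>R_zero_section\<close>).

At \<open>p = 0\<close> the almost complex structure sends \<open>(a, 0)\<close> to \<open>A / \<lambda>(0)\<close> times the vertical vector
\<open>g(a, -)\<close>.  Hence \<open>R(X, JY, JY, X) = c A g(a', a)\<^sup>2\<close> for \<open>X = (a, 0)\<close> and \<open>Y = (a', 0)\<close>.  Taking
\<open>X = Y\<close>, the holomorphic sectional curvature of \<open>X\<close> is \<open>c / A\<close>.  Taking \<open>a\<close> and \<open>a'\<close> orthogonal,
the value is 0.  On the other hand, if the holomorphic sectional curvature is a constant \<open>k\<close>, then
polarization together with the \<open>J\<close>-invariance of the curvature of a Kaehler metric forces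
\<open>R(X, JY, JY, X) = (k / 4) |X|\<^sup>2 |Y|\<^sup>2\<close> whenever \<open>X\<close> is orthogonal to \<open>Y\<close> and \<open>JY\<close> (lemma
\<open>constant_holomorphic_imp_mixed\<close>).  In dimension at least 2 such \<open>a\<close> and \<open>a'\<close> exist, so \<open>k = 0\<close>, and
then \<open>c / A = k\<close> gives \<open>c = 0\<close>.  Thus a constant \<open>k\<close> can only be 0, and only when \<open>c = 0\<close>, which is
the contrapositive of both halves of the theorem.

The computation runs in one induced chart, where the curvature is expressed by the first
derivatives of the Koszul expression for \<open>G(\<nabla>\<^sub>X Y, Z)\<close> and by products of Christoffel symbols
(lemma \<open>curvature_koszul\<close>).  This form avoids inverting \<open>G\<close>; only the differentiability of the
Christoffel symbols has to be known, and it follows from an implicit function argument for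
linear systems (lemma \<open>differentiable_implicit_linear\<close>).  The \<open>J\<close>-invariance of the curvature comes
from \<open>\<nabla>J = 0\<close>, which is derived from the vanishing of the Nijenhuis tensor and the closedness of the
fundamental form.\<close>

section \<open>Directional derivatives\<close>

lemma has_derivative_dir_deriv:
  assumes "f differentiable (at u)"
  shows "(f has_derivative dir_deriv f u) (at u)"
proof -
  have "dir_deriv f u = frechet_derivative f (at u)" by (auto simp: dir_deriv_def)
  with assms show ?thesis by (simp add: frechet_derivative_works)
qed

lemma dir_deriv_eqI:
  assumes "(f has_derivative D) (at u)"
  shows "dir_deriv f u v = D v"
  using frechet_derivative_at[OF assms] by (simp add: dir_deriv_def)

lemma linear_dir_deriv:
  assumes "f differentiable (at u)"
  shows "linear (dir_deriv f u)"
  using has_derivative_dir_deriv[OF assms] has_derivative_linear by blast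

lemma dir_deriv_add:
  assumes "f differentiable (at u)" "h differentiable (at u)"
  shows "dir_deriv (\<lambda>x. f x + h x) u v = dir_deriv f u v + dir_deriv h u v"
  by (rule dir_deriv_eqI, intro derivative_intros has_derivative_dir_deriv assms)

lemma dir_deriv_diff:
  assumes "f differentiable (at u)" "h differentiable (at u)"
  shows "dir_deriv (\<lambda>x. f x - h x) u v = dir_deriv f u v - dir_deriv h u v"
  by (rule dir_deriv_eqI, intro derivative_intros has_derivative_dir_deriv assms)

lemma dir_deriv_scaleR:
  assumes "f differentiable (at u)"
  shows "dir_deriv (\<lambda>x. r *\<^sub>R f x) u v = r *\<^sub>R dir_deriv f u v"
  by (rule dir_deriv_eqI, intro derivative_intros has_derivative_dir_deriv assms)

lemma dir_deriv_cmult: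
  fixes f :: "'e::euclidean_space \<Rightarrow> real"
  assumes "f differentiable (at u)"
  shows "dir_deriv (\<lambda>x. r * f x) u v = r * dir_deriv f u v"
  by (rule dir_deriv_eqI, intro derivative_intros has_derivative_dir_deriv assms)

lemma dir_deriv_const: "dir_deriv (\<lambda>x. k) u v = 0"
  by (rule dir_deriv_eqI, intro derivative_intros)

lemma dir_deriv_inner:
  assumes "f differentiable (at u)"
  shows "dir_deriv (\<lambda>x. f x \<bullet> b) u v = dir_deriv f u v \<bullet> b"
  by (rule dir_deriv_eqI, intro derivative_intros has_derivative_dir_deriv assms)

lemma dir_deriv_cong:
  assumes "open S" "u \<in> S" "\<And>x. x \<in> S \<Longrightarrow> f x = h x"
  shows "dir_deriv f u v = dir_deriv h u v"
proof -
  have "(f has_derivative D) (at u) \<longleftrightarrow> (h has_derivative D) (at u)" for D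
    using has_derivative_transform_within_open[of f D u UNIV S h]
      has_derivative_transform_within_open[of h D u UNIV S f] assms by auto
  then show ?thesis by (simp add: dir_deriv_def frechet_derivative_def)
qed

lemma differentiable_cong_open:
  assumes "open S" "u \<in> S" "\<And>x. x \<in> S \<Longrightarrow> f x = h x" "f differentiable (at u)"
  shows "h differentiable (at u)"
  using assms has_derivative_transform_within_open[of f _ u UNIV S h]
  unfolding differentiable_def by blast

lemma has_real_derivative_along_line:
  fixes f :: "'e::euclidean_space \<Rightarrow> real"
  assumes "f differentiable (at (u + s *\<^sub>R v))"
  shows "((\<lambda>t. f (u + t *\<^sub>R v)) has_real_derivative dir_deriv f (u + s *\<^sub>R v) v) (at s)"
proof -
  have l: "((\<lambda>t. u + t *\<^sub>R v) has_derivative (\<lambda>t. t *\<^sub>R v)) (at s)"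
    by (auto intro!: derivative_eq_intros)
  have "((\<lambda>t. f (u + t *\<^sub>R v)) has_derivative (\<lambda>t. dir_deriv f (u + s *\<^sub>R v) (t *\<^sub>R v))) (at s)"
    using has_derivative_compose[OF l has_derivative_dir_deriv[OF assms]] .
  moreover have "dir_deriv f (u + s *\<^sub>R v) (t *\<^sub>R v) = dir_deriv f (u + s *\<^sub>R v) v * t" for t
    using linear_dir_deriv[OF assms] by (simp add: linear_cmul)
  ultimately show ?thesis by (simp add: has_field_derivative_def)
qed

lemma linear_euclidean_expand:
  fixes w :: "'b::euclidean_space"
  assumes "linear L"
  shows "L w = (\<Sum>b\<in>Basis. (w \<bullet> b) *\<^sub>R L b)"
proof -
  have "L w = L (\<Sum>b\<in>Basis. (w \<bullet> b) *\<^sub>R b)" by (simp add: euclidean_representation)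
  also have "\<dots> = (\<Sum>b\<in>Basis. (w \<bullet> b) *\<^sub>R L b)"
    using assms by (simp add: linear_sum linear_cmul)
  finally show ?thesis .
qed

text \<open>Product rule for the evaluation of a varying linear map at a varying vector.  It is the only product
rule used below: metrics, endomorphism fields and Christoffel symbols all enter as such families.\<close>

lemma has_derivative_linear_family:
  fixes F :: "'e::euclidean_space \<Rightarrow> 'b::euclidean_space \<Rightarrow> 'c::real_normed_vector"
  assumes S: "open S" "u \<in> S"
    and lin: "\<And>x. x \<in> S \<Longrightarrow> linear (F x)"
    and F: "\<And>w. (\<lambda>x. F x w) differentiable (at u)"
    and W: "W differentiable (at u)"
  shows "((\<lambda>x. F x (W x)) has_derivative
           (\<lambda>v. dir_deriv (\<lambda>x. F x (W u)) u v + F u (dir_deriv W u v))) (at u)"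
proof -
  define D where "D = (\<lambda>W0 DW v. \<Sum>b\<in>Basis. (W0 \<bullet> b) *\<^sub>R dir_deriv (\<lambda>x. F x b) u v + (DW v \<bullet> b) *\<^sub>R F u b)"
  have *: "((\<lambda>x. F x (V x)) has_derivative D (V u) DV) (at u)"
    if V: "(V has_derivative DV) (at u)" for V DV
  proof -
    have "((\<lambda>x. \<Sum>b\<in>Basis. (V x \<bullet> b) *\<^sub>R F x b) has_derivative D (V u) DV) (at u)"
      unfolding D_def
      by (intro derivative_intros V has_derivative_dir_deriv F)
    then show ?thesis
      by (rule has_derivative_transform_within_open[OF _ S])
        (use linear_euclidean_expand[OF lin] in auto)
  qed
  have 1: "dir_deriv (\<lambda>x. F x (W u)) u v = D (W u) (\<lambda>v. 0) v" for v
    by (rule dir_deriv_eqI) (use *[of "\<lambda>x. W u" "\<lambda>v. 0"] in simp)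
  have 2: "F u w = (\<Sum>b\<in>Basis. (w \<bullet> b) *\<^sub>R F u b)" for w
    using linear_euclidean_expand[OF lin[OF S(2)]] .
  have "D (W u) (dir_deriv W u) v = dir_deriv (\<lambda>x. F x (W u)) u v + F u (dir_deriv W u v)" for v
    unfolding 1 2[of "dir_deriv W u v"] by (simp add: D_def sum.distrib)
  moreover have "D (W u) (dir_deriv W u) = (\<lambda>v. D (W u) (dir_deriv W u) v)" by simp
  ultimately show ?thesis using *[OF has_derivative_dir_deriv[OF W]] by simp
qed

lemmas dir_deriv_linear_family = dir_deriv_eqI[OF has_derivative_linear_family]

lemma differentiable_linear_family:
  fixes F :: "'e::euclidean_space \<Rightarrow> 'b::euclidean_space \<Rightarrow> 'c::real_normed_vector"
  assumes "open S" "u \<in> S" "\<And>x. x \<in> S \<Longrightarrow> linear (F x)"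
    and "\<And>w. (\<lambda>x. F x w) differentiable (at u)" "W differentiable (at u)"
  shows "(\<lambda>x. F x (W x)) differentiable (at u)"
  using has_derivative_linear_family[OF assms] unfolding differentiable_def by blast

lemma linear_dir_deriv_family:
  fixes F :: "'e::euclidean_space \<Rightarrow> 'b::real_vector \<Rightarrow> 'c::real_normed_vector"
  assumes S: "open S" "u \<in> S"
    and lin: "\<And>x. x \<in> S \<Longrightarrow> linear (F x)"
    and F: "\<And>w. (\<lambda>x. F x w) differentiable (at u)"
  shows "linear (\<lambda>w. dir_deriv (\<lambda>x. F x w) u v)"
proof (rule linearI)
  fix a b r
  have "dir_deriv (\<lambda>x. F x (a + b)) u v = dir_deriv (\<lambda>x. F x a + F x b) u v"
    "dir_deriv (\<lambda>x. F x (r *\<^sub>R a)) u v = dir_deriv (\<lambda>x. r *\<^sub>R F x a) u v"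
    by (rule dir_deriv_cong[OF S], simp add: lin linear_add linear_cmul)+
  then show "dir_deriv (\<lambda>x. F x (a + b)) u v = dir_deriv (\<lambda>x. F x a) u v + dir_deriv (\<lambda>x. F x b) u v"
    "dir_deriv (\<lambda>x. F x (r *\<^sub>R a)) u v = r *\<^sub>R dir_deriv (\<lambda>x. F x a) u v"
    by (simp_all add: dir_deriv_add dir_deriv_scaleR F)
qed

definition C2_on :: "'e::euclidean_space set \<Rightarrow> ('e \<Rightarrow> 'b::real_normed_vector) \<Rightarrow> bool" where
  "C2_on S f \<longleftrightarrow> (\<forall>u\<in>S. f differentiable (at u)) \<and>
     (\<forall>v. \<forall>u\<in>S. (\<lambda>x. dir_deriv f x v) differentiable (at u)) \<and>
     (\<forall>v w. continuous_on S (\<lambda>u. dir_deriv (\<lambda>x. dir_deriv f x v) u w))"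

lemma smooth_on_imp_C2_on:
  fixes f :: "'e::euclidean_space \<Rightarrow> 'b::real_normed_vector"
  assumes S: "open S" and f: "smooth_on S f"
  shows "C2_on S f"
proof -
  have "C_k_on (Suc (Suc 0)) S f" using f by (simp add: smooth_on_def)
  then have d0: "f differentiable_on S"
    and d1: "\<And>v. (\<lambda>x. frechet_derivative f (at x within S) v) differentiable_on S"
    and d2: "\<And>v w. continuous_on S (\<lambda>x. frechet_derivative
        (\<lambda>x. frechet_derivative f (at x within S) v) (at x within S) w)"
    by auto
  have at: "at x within S = at x" if "x \<in> S" for x
    using at_within_open[OF that S] .
  have e1: "frechet_derivative f (at x within S) v = dir_deriv f x v" if "x \<in> S" for x v
    using at[OF that] by (simp add: dir_deriv_def)
  have 1: "(\<lambda>x. dir_deriv f x v) differentiable (at u)" if "u \<in> S" for u v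
    using d1[of v, unfolded differentiable_on_eq_differentiable_at[OF S], rule_format, OF that]
    by (rule differentiable_cong_open[OF S that, rotated]) (simp add: e1)
  have e2: "frechet_derivative (\<lambda>x. frechet_derivative f (at x within S) v) (at u within S) w
     = dir_deriv (\<lambda>x. dir_deriv f x v) u w" if "u \<in> S" for u v w
    using dir_deriv_cong[OF S that e1, where v = w] by (simp add: at[OF that] dir_deriv_def)
  have 2: "continuous_on S (\<lambda>u. dir_deriv (\<lambda>x. dir_deriv f x v) u w)" for v w
    using d2[of v w] by (rule continuous_on_eq) (simp add: e2)
  show ?thesis
    using d0[unfolded differentiable_on_eq_differentiable_at[OF S]] 1 2 by (simp add: C2_on_def)
qed

text \<open>Two applications of the mean value theorem, first along \<open>v\<close> and then along \<open>w\<close>.  The left-hand side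
is symmetric in \<open>v\<close> and \<open>w\<close>, which is what makes second derivatives commute.\<close>

lemma second_difference_mvt:
  fixes f :: "'e::euclidean_space \<Rightarrow> real"
  assumes f: "C2_on S f" and h: "h > 0"
    and S: "\<And>s t. 0 \<le> s \<Longrightarrow> s \<le> h \<Longrightarrow> 0 \<le> t \<Longrightarrow> t \<le> h \<Longrightarrow> u + s *\<^sub>R v + t *\<^sub>R w \<in> S"
  obtains s t where "0 < s" "s < h" "0 < t" "t < h"
    "f (u + h *\<^sub>R v + h *\<^sub>R w) - f (u + h *\<^sub>R v) - f (u + h *\<^sub>R w) + f u
      = h * h * dir_deriv (\<lambda>x. dir_deriv f x v) (u + s *\<^sub>R v + t *\<^sub>R w) w"
proof -
  have df: "f differentiable (at x)" "(\<lambda>x. dir_deriv f x v) differentiable (at x)" if "x \<in> S" for x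
    using f that by (auto simp: C2_on_def)
  define \<phi> where "\<phi> s = f ((u + h *\<^sub>R w) + s *\<^sub>R v) - f (u + s *\<^sub>R v)" for s
  define \<psi> where "\<psi> s = dir_deriv f ((u + h *\<^sub>R w) + s *\<^sub>R v) v - dir_deriv f (u + s *\<^sub>R v) v" for s
  have in1: "(u + h *\<^sub>R w) + s *\<^sub>R v \<in> S" "u + s *\<^sub>R v \<in> S" if "0 \<le> s" "s \<le> h" for s
    using S[of s h] S[of s 0] that h by (auto simp: algebra_simps)
  have "(\<phi> has_real_derivative \<psi> s) (at s)" if "0 \<le> s" "s \<le> h" for s
    unfolding \<phi>_def \<psi>_def
    by (intro derivative_intros has_real_derivative_along_line df in1 that)
  from MVT2[OF h this] obtain s where s: "0 < s" "s < h" "\<phi> h - \<phi> 0 = h * \<psi> s" by auto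
  have in2: "(u + s *\<^sub>R v) + t *\<^sub>R w \<in> S" if "0 \<le> t" "t \<le> h" for t
    using S[of s t] that s by auto
  have "((\<lambda>t. dir_deriv f ((u + s *\<^sub>R v) + t *\<^sub>R w) v) has_real_derivative
      dir_deriv (\<lambda>x. dir_deriv f x v) ((u + s *\<^sub>R v) + t *\<^sub>R w) w) (at t)"
    if "0 \<le> t" "t \<le> h" for t
    by (intro has_real_derivative_along_line df in2 that)
  from MVT2[OF h this] obtain t where t: "0 < t" "t < h"
    "dir_deriv f ((u + s *\<^sub>R v) + h *\<^sub>R w) v - dir_deriv f ((u + s *\<^sub>R v) + 0 *\<^sub>R w) v
     = h * dir_deriv (\<lambda>x. dir_deriv f x v) ((u + s *\<^sub>R v) + t *\<^sub>R w) w" by auto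
  have "\<psi> s = h * dir_deriv (\<lambda>x. dir_deriv f x v) (u + s *\<^sub>R v + t *\<^sub>R w) w"
    using t(3) by (simp add: \<psi>_def algebra_simps)
  with s(3) have "f (u + h *\<^sub>R v + h *\<^sub>R w) - f (u + h *\<^sub>R v) - f (u + h *\<^sub>R w) + f u
      = h * h * dir_deriv (\<lambda>x. dir_deriv f x v) (u + s *\<^sub>R v + t *\<^sub>R w) w"
    by (simp add: \<phi>_def algebra_simps)
  with s t that show ?thesis by blast
qed

lemma dir_deriv_commute_real:
  fixes f :: "'e::euclidean_space \<Rightarrow> real"
  assumes S: "open S" "u \<in> S" and f: "C2_on S f"
  shows "dir_deriv (\<lambda>x. dir_deriv f x v) u w = dir_deriv (\<lambda>x. dir_deriv f x w) u v"
proof (rule ccontr)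
  let ?a = "\<lambda>x. dir_deriv (\<lambda>x. dir_deriv f x v) x w"
  let ?b = "\<lambda>x. dir_deriv (\<lambda>x. dir_deriv f x w) x v"
  assume ne: "?a u \<noteq> ?b u"
  define e where "e = \<bar>?a u - ?b u\<bar> / 2"
  have e: "e > 0" using ne by (simp add: e_def)
  have c: "continuous_on S ?a" "continuous_on S ?b" using f by (auto simp: C2_on_def)
  obtain d1 where d1: "d1 > 0" "\<And>x. x \<in> S \<Longrightarrow> dist x u < d1 \<Longrightarrow> dist (?a x) (?a u) < e"
    using c(1) S(2) e unfolding continuous_on_iff by blast
  obtain d2 where d2: "d2 > 0" "\<And>x. x \<in> S \<Longrightarrow> dist x u < d2 \<Longrightarrow> dist (?b x) (?b u) < e"
    using c(2) S(2) e unfolding continuous_on_iff by blast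
  obtain d3 where d3: "d3 > 0" "ball u d3 \<subseteq> S" using S openE by blast
  define d where "d = min d1 (min d2 d3)"
  define N where "N = norm v + norm w + 1"
  define h where "h = d / (2 * N)"
  have d: "d > 0" using d1 d2 d3 by (simp add: d_def)
  have nn: "N > 0" unfolding N_def by (smt (verit) norm_ge_zero)
  have h: "h > 0" using d nn by (simp add: h_def)
  have near: "dist (u + s *\<^sub>R v + t *\<^sub>R w) u < d" if "0 \<le> s" "s \<le> h" "0 \<le> t" "t \<le> h" for s t
  proof -
    have "dist (u + s *\<^sub>R v + t *\<^sub>R w) u = norm (s *\<^sub>R v + t *\<^sub>R w)"
      by (simp add: dist_norm)
    also have "\<dots> \<le> s * norm v + t * norm w"
      using norm_triangle_ineq[of "s *\<^sub>R v" "t *\<^sub>R w"] that by simp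
    also have "\<dots> \<le> h * norm v + h * norm w"
      using that by (intro add_mono mult_right_mono) auto
    also have "\<dots> \<le> h * N" using h by (simp add: N_def algebra_simps)
    also have "\<dots> = d / 2" using nn by (simp add: h_def)
    finally show ?thesis using d by simp
  qed
  have in1: "u + s *\<^sub>R v + t *\<^sub>R w \<in> S" if "0 \<le> s" "s \<le> h" "0 \<le> t" "t \<le> h" for s t
    using near[OF that] d3(2) by (auto simp: d_def dist_commute)
  have in2: "u + s *\<^sub>R w + t *\<^sub>R v \<in> S" if "0 \<le> s" "s \<le> h" "0 \<le> t" "t \<le> h" for s t
    using in1[of t s] that by (simp add: algebra_simps)
  obtain s t where 1: "0 < s" "s < h" "0 < t" "t < h"
    "f (u + h *\<^sub>R v + h *\<^sub>R w) - f (u + h *\<^sub>R v) - f (u + h *\<^sub>R w) + f u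
      = h * h * ?a (u + s *\<^sub>R v + t *\<^sub>R w)"
    using second_difference_mvt[OF f h in1] by blast
  obtain s' t' where 2: "0 < s'" "s' < h" "0 < t'" "t' < h"
    "f (u + h *\<^sub>R w + h *\<^sub>R v) - f (u + h *\<^sub>R w) - f (u + h *\<^sub>R v) + f u
      = h * h * ?b (u + s' *\<^sub>R w + t' *\<^sub>R v)"
    using second_difference_mvt[OF f h in2] by blast
  have "h * h * ?a (u + s *\<^sub>R v + t *\<^sub>R w) = h * h * ?b (u + s' *\<^sub>R w + t' *\<^sub>R v)"
    using 1(5) 2(5) by (simp add: algebra_simps)
  then have eq: "?a (u + s *\<^sub>R v + t *\<^sub>R w) = ?b (u + s' *\<^sub>R w + t' *\<^sub>R v)" using h by simp
  have "dist (?a (u + s *\<^sub>R v + t *\<^sub>R w)) (?a u) < e"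
    using 1 near[of s t] in1[of s t] by (intro d1(2)) (auto simp: d_def)
  moreover have "dist (?b (u + s' *\<^sub>R w + t' *\<^sub>R v)) (?b u) < e"
    using 2 near[of t' s'] in2[of s' t'] by (intro d2(2)) (auto simp: d_def algebra_simps)
  ultimately have "\<bar>?a u - ?b u\<bar> < 2 * e" using eq by (simp add: dist_real_def)
  then show False by (simp add: e_def)
qed

lemma C2_on_inner:
  assumes S: "open S" and f: "C2_on S f"
  shows "C2_on S (\<lambda>x. f x \<bullet> b)"
proof -
  have d: "f differentiable (at u)" "(\<lambda>x. dir_deriv f x v) differentiable (at u)" if "u \<in> S" for u v
    using f that by (auto simp: C2_on_def)
  have e1: "dir_deriv (\<lambda>x. f x \<bullet> b) u v = dir_deriv f u v \<bullet> b" if "u \<in> S" for u v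
    by (rule dir_deriv_inner[OF d(1)[OF that]])
  have e2: "dir_deriv (\<lambda>x. dir_deriv (\<lambda>x. f x \<bullet> b) x v) u w
      = dir_deriv (\<lambda>x. dir_deriv f x v) u w \<bullet> b" if "u \<in> S" for u v w
    using dir_deriv_cong[OF S that e1, where v = w] dir_deriv_inner[OF d(2)[OF that]] by simp
  have i: "(\<lambda>x. h x \<bullet> b) differentiable (at u)" if "h differentiable (at u)"
    for h :: "'a \<Rightarrow> 'b" and u
    using has_derivative_inner_left that unfolding differentiable_def by blast
  have "(\<lambda>x. dir_deriv (\<lambda>x. f x \<bullet> b) x v) differentiable (at u)" if "u \<in> S" for u v
    using i[OF d(2)[OF that]]
    by (rule differentiable_cong_open[OF S that, rotated]) (simp add: e1)
  moreover have "continuous_on S (\<lambda>u. dir_deriv (\<lambda>x. dir_deriv (\<lambda>x. f x \<bullet> b) x v) u w)" for v w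
  proof -
    have "continuous_on S (\<lambda>u. dir_deriv (\<lambda>x. dir_deriv f x v) u w \<bullet> b)"
      using f by (auto simp: C2_on_def intro!: continuous_intros)
    then show ?thesis by (rule continuous_on_eq) (simp add: e2)
  qed
  ultimately show ?thesis using i d by (auto simp: C2_on_def)
qed

text \<open>The vector-valued case reduces to the real-valued one componentwise, since the mean value theorem
holds as an equality only for real functions.\<close>

lemma dir_deriv_commute:
  fixes f :: "'e::euclidean_space \<Rightarrow> 'b::euclidean_space"
  assumes S: "open S" "u \<in> S" and f: "C2_on S f"
  shows "dir_deriv (\<lambda>x. dir_deriv f x v) u w = dir_deriv (\<lambda>x. dir_deriv f x w) u v"
proof (rule euclidean_eqI)
  fix b :: 'b assume "b \<in> Basis"
  have d: "f differentiable (at u)" "(\<lambda>x. dir_deriv f x v) differentiable (at u)" if "u \<in> S" for u v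
    using f that by (auto simp: C2_on_def)
  have "dir_deriv (\<lambda>x. dir_deriv (\<lambda>x. f x \<bullet> b) x v) u w
      = dir_deriv (\<lambda>x. dir_deriv f x v) u w \<bullet> b" for v w
    using dir_deriv_cong[OF S dir_deriv_inner[OF d(1)], where v = w] dir_deriv_inner[OF d(2)[OF S(2)]]
    by simp
  then show "dir_deriv (\<lambda>x. dir_deriv f x v) u w \<bullet> b = dir_deriv (\<lambda>x. dir_deriv f x w) u v \<bullet> b"
    using dir_deriv_commute_real[OF S C2_on_inner[OF S(1) f], of b v w] by simp
qed

section \<open>Varying inner products\<close>

text \<open>Riesz representation for an inner product that is not the ambient one.  By positivity the map
\<open>w \<mapsto> B w\<close> is injective, hence onto by dimension.\<close>

lemma posdef_representation:
  fixes B :: "'e::euclidean_space \<Rightarrow> 'e \<Rightarrow> real"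
  assumes bil: "bilinear B" and pos: "\<And>v. v \<noteq> 0 \<Longrightarrow> B v v > 0" and \<phi>: "linear \<phi>"
  obtains w where "\<And>z. B w z = \<phi> z"
proof -
  have lin1: "linear (\<lambda>w. B w z)" and lin2: "linear (B w)" for w z
    using bil by (auto simp: bilinear_def)
  define L where "L w = (\<Sum>b\<in>Basis. B w b *\<^sub>R b)" for w
  have Lb: "L w \<bullet> b = B w b" if "b \<in> Basis" for w b
    using that by (simp add: L_def)
  have linL: "linear L"
    by (rule linearI)
      (simp_all add: L_def linear_add[OF lin1] linear_cmul[OF lin1] scaleR_left_distrib
        sum.distrib scaleR_sum_right)
  have "w = 0" if "L w = 0" for w
  proof (rule ccontr)
    assume "w \<noteq> 0"
    have "B w b = 0" if "b \<in> Basis" for b using Lb[OF that, of w] \<open>L w = 0\<close> by simp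
    then have "B w w = 0" using linear_euclidean_expand[OF lin2, of w w] by simp
    then show False using pos[OF \<open>w \<noteq> 0\<close>] by simp
  qed
  then have "inj L" using linL by (simp add: linear_injective_0)
  then have "surj L" using linL linear_injective_imp_surjective by blast
  then obtain w where w: "L w = (\<Sum>b\<in>Basis. \<phi> b *\<^sub>R b)" by (metis surjD)
  have "B w b = \<phi> b" if "b \<in> Basis" for b
    using Lb[OF that, of w] that by (simp add: w)
  then have "B w z = \<phi> z" for z
    using linear_euclidean_expand[OF lin2, of w z] linear_euclidean_expand[OF \<phi>, of z] by simp
  with that show ?thesis by blast
qed

lemma posdef_nondegenerate:
  fixes B :: "'e::euclidean_space \<Rightarrow> 'e \<Rightarrow> real"
  assumes bil: "bilinear B" and pos: "\<And>v. v \<noteq> 0 \<Longrightarrow> B v v > 0"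
    and eq: "\<And>z. B w z = B w' z"
  shows "w = w'"
proof (rule ccontr)
  assume "w \<noteq> w'"
  then have "B (w - w') (w - w') > 0" by (simp add: pos)
  moreover have "B (w - w') (w - w') = 0" using bil eq by (simp add: bilinear_lsub)
  ultimately show False by simp
qed

text \<open>The candidate derivative \<open>D\<close> is what formal differentiation of the equation \<open>G x (W x) z = K x z\<close>
gives.  The remainder \<open>E x = W x - W u - D (x - u)\<close> satisfies \<open>G x (E x) z = \<rho> z x\<close> with \<open>\<rho> z\<close>
vanishing to first order at \<open>u\<close>.  To bound the norm of \<open>E x\<close> by the \<open>\<rho>\<close>, its coordinates are written
as \<open>G u (d b) (E x)\<close> with a \<open>G u\<close>-dual basis \<open>d\<close>; replacing \<open>G u\<close> by \<open>G x\<close> costs at most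
\<open>\<epsilon> x * norm (E x)\<close>, which is absorbed in the left-hand side as soon as \<open>\<epsilon> x < 1/2\<close>.\<close>

lemma differentiable_implicit_linear:
  fixes G :: "'e::euclidean_space \<Rightarrow> 'f::euclidean_space \<Rightarrow> 'f \<Rightarrow> real"
  assumes S: "open S" "u \<in> S"
    and bil: "\<And>x. x \<in> S \<Longrightarrow> bilinear (G x)"
    and sym: "\<And>v w. G u v w = G u w v"
    and pos: "\<And>v. v \<noteq> 0 \<Longrightarrow> G u v v > 0"
    and dG: "\<And>v w. (\<lambda>x. G x v w) differentiable (at u)"
    and dK: "\<And>z. (\<lambda>x. K x z) differentiable (at u)"
    and W: "\<And>x z. x \<in> S \<Longrightarrow> G x (W x) z = K x z"
  shows "W differentiable (at u)"
proof -
  have lin1: "linear (\<lambda>w. G x w z)" and lin2: "linear (G x w)" if "x \<in> S" for x w z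
    using bil[OF that] by (auto simp: bilinear_def)
  note bilu = bil[OF S(2)]
  define D\<rho> where "D\<rho> z v = dir_deriv (\<lambda>x. K x z) u v - dir_deriv (\<lambda>x. G x (W u) z) u v" for z v
  have lin\<rho>: "linear (\<lambda>z. D\<rho> z v)" for v
  proof -
    have "linear (K x)" if "x \<in> S" for x
      using lin2[OF that, of "W x"] W[OF that] by (simp add: linear_iff)
    then show ?thesis
      unfolding D\<rho>_def
      by (intro linear_compose_sub linear_dir_deriv_family[OF S] lin2 dK dG)
  qed
  have "\<exists>w. \<forall>z. G u w z = D\<rho> z v" for v
    using posdef_representation[OF bilu pos lin\<rho>] by metis
  then obtain D where D: "\<And>v z. G u (D v) z = D\<rho> z v" by metis
  have linD: "linear D"
  proof (rule linearI)
    fix a b r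
    have l: "linear (D\<rho> z)" for z
      unfolding D\<rho>_def by (intro linear_compose_sub linear_dir_deriv dK dG)
    show "D (a + b) = D a + D b"
      by (rule posdef_nondegenerate[OF bilu pos]) (simp_all add: D bilinear_ladd[OF bilu] linear_add[OF l])
    show "D (r *\<^sub>R a) = r *\<^sub>R D a"
      by (rule posdef_nondegenerate[OF bilu pos]) (simp_all add: D bilinear_lmul[OF bilu] linear_cmul[OF l])
  qed
  then have blD: "bounded_linear D" by (simp add: linear_conv_bounded_linear)
  define E where "E x = W x - W u - D (x - u)" for x
  define \<rho> where "\<rho> z x = K x z - G x (W u) z - G x (D (x - u)) z" for z x
  have \<rho>E: "\<rho> z x = G x (E x) z" if "x \<in> S" for z x
    using bil[OF that] W[OF that] by (simp add: \<rho>_def E_def bilinear_lsub)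
  have d\<rho>: "(\<rho> z has_derivative (\<lambda>v. 0)) (at u)" for z
  proof -
    have dD: "((\<lambda>x. D (x - u)) has_derivative D) (at u)"
      by (auto intro!: derivative_eq_intros has_derivative_compose[of "\<lambda>x. x - u", OF _
          bounded_linear_imp_has_derivative[OF blD]])
    have "(\<lambda>x. D (x - u)) differentiable (at u)"
      using dD unfolding differentiable_def by blast
    then have "((\<lambda>x. G x (D (x - u)) z) has_derivative
        (\<lambda>v. dir_deriv (\<lambda>x. G x (D (u - u)) z) u v + G u (dir_deriv (\<lambda>x. D (x - u)) u v) z)) (at u)"
      by (intro has_derivative_linear_family[OF S, where F = "\<lambda>x w. G x w z"] lin1 dG)
    moreover have "dir_deriv (\<lambda>x. G x (D (u - u)) z) u v = 0" for v
    proof -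
      have "G x (D (u - u)) z = 0" if "x \<in> S" for x
        using bil[OF that] linD by (simp add: linear_0 bilinear_lzero)
      then have "dir_deriv (\<lambda>x. G x (D (u - u)) z) u v = dir_deriv (\<lambda>x. 0) u v"
        by (intro dir_deriv_cong[OF S])
      then show ?thesis by (simp add: dir_deriv_const)
    qed
    ultimately have *: "((\<lambda>x. G x (D (x - u)) z) has_derivative (\<lambda>v. D\<rho> z v)) (at u)"
      by (simp add: dir_deriv_eqI[OF dD] D)
    have "((\<lambda>x. K x z - G x (W u) z - G x (D (x - u)) z) has_derivative
       (\<lambda>v. dir_deriv (\<lambda>x. K x z) u v - dir_deriv (\<lambda>x. G x (W u) z) u v - D\<rho> z v)) (at u)"
      by (intro has_derivative_diff has_derivative_dir_deriv dK dG *)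
    then show ?thesis by (simp add: \<rho>_def[abs_def] D\<rho>_def)
  qed
  have "\<exists>w. \<forall>z. G u w z = z \<bullet> b" for b
    using posdef_representation[OF bilu pos, of "\<lambda>z. z \<bullet> b"]
    by (metis bounded_linear.linear bounded_linear_inner_left)
  then obtain d where d: "\<And>b z. G u (d b) z = z \<bullet> b" by metis
  \<comment> \<open>The cost of replacing \<open>G u\<close> by \<open>G x\<close> in the pairing with the dual basis.\<close>
  define \<epsilon> where "\<epsilon> x = (\<Sum>b\<in>Basis. \<Sum>b'\<in>Basis. \<bar>G x b' (d b) - G u b' (d b)\<bar>)" for x
  have cG: "((\<lambda>x. G x v w) \<longlongrightarrow> G u v w) (at u)" for v w
    using differentiable_imp_continuous_within[OF dG] by (simp add: continuous_within)
  have "(\<epsilon> \<longlongrightarrow> (\<Sum>b\<in>Basis. \<Sum>b'\<in>Basis. \<bar>G u b' (d b) - G u b' (d b)\<bar>)) (at u)"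
    unfolding \<epsilon>_def[abs_def] by (intro tendsto_intros cG)
  then have "(\<epsilon> \<longlongrightarrow> 0) (at u)" by simp
  then have ev1: "eventually (\<lambda>x. \<epsilon> x < 1/2) (at u)" by (rule order_tendstoD(2)) simp
  have ev2: "eventually (\<lambda>x. x \<in> S) (at u)"
    using S eventually_at_topological by blast
  have bound: "norm (E x) \<le> 2 * (\<Sum>b\<in>Basis. \<bar>\<rho> (d b) x\<bar>)" if x: "x \<in> S" "\<epsilon> x < 1/2" for x
  proof -
    have 1: "\<bar>E x \<bullet> b\<bar> \<le> \<bar>\<rho> (d b) x\<bar> + norm (E x) * (\<Sum>b'\<in>Basis. \<bar>G x b' (d b) - G u b' (d b)\<bar>)" for b
    proof -
      have "E x \<bullet> b = \<rho> (d b) x - (G x (E x) (d b) - G u (E x) (d b))"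
        using d[of b "E x"] sym by (simp add: \<rho>E[OF x(1)])
      moreover have "G x (E x) (d b) - G u (E x) (d b)
          = (\<Sum>b'\<in>Basis. (E x \<bullet> b') * (G x b' (d b) - G u b' (d b)))"
        using linear_euclidean_expand[OF lin1[OF x(1)], of "E x" "d b"]
          linear_euclidean_expand[OF lin1[OF S(2)], of "E x" "d b"]
        by (simp add: sum_subtractf right_diff_distrib)
      moreover have "\<bar>\<Sum>b'\<in>Basis. (E x \<bullet> b') * (G x b' (d b) - G u b' (d b))\<bar>
          \<le> norm (E x) * (\<Sum>b'\<in>Basis. \<bar>G x b' (d b) - G u b' (d b)\<bar>)"
        unfolding sum_distrib_left
        by (intro order_trans[OF sum_abs] sum_mono)
          (simp add: abs_mult mult_right_mono Basis_le_norm)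
      ultimately show ?thesis by linarith
    qed
    have "norm (E x) \<le> (\<Sum>b\<in>Basis. \<bar>E x \<bullet> b\<bar>)" by (rule norm_le_l1)
    also have "\<dots> \<le> (\<Sum>b\<in>Basis. \<bar>\<rho> (d b) x\<bar>) + norm (E x) * \<epsilon> x"
      unfolding \<epsilon>_def sum_distrib_left[of "norm (E x)" _ Basis] sum.distrib[symmetric]
      using 1 by (intro sum_mono) (simp add: sum_distrib_left)
    also have "norm (E x) * \<epsilon> x \<le> norm (E x) * (1/2)"
      using x(2) by (intro mult_left_mono) auto
    finally show ?thesis by simp
  qed
  have E0: "((\<lambda>x. norm (E x) / norm (x - u)) \<longlongrightarrow> 0) (at u)"
  proof (rule tendsto_sandwich[where f = "\<lambda>x. 0"
        and h = "\<lambda>x. 2 * (\<Sum>b\<in>Basis. \<bar>\<rho> (d b) x\<bar> / norm (x - u))"])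
    have \<rho>0: "\<rho> z u = 0" for z
      using \<rho>E[OF S(2), of z] bilu by (simp add: E_def linear_0[OF linD] bilinear_lzero)
    have t: "((\<lambda>x. \<bar>\<rho> z x\<bar> / norm (x - u)) \<longlongrightarrow> 0) (at u)" for z
      using d\<rho>[of z] unfolding has_derivative_iff_norm by (simp add: \<rho>0)
    have "((\<lambda>x. 2 * (\<Sum>b\<in>Basis. \<bar>\<rho> (d b) x\<bar> / norm (x - u))) \<longlongrightarrow> 2 * (\<Sum>b\<in>(Basis::'f set). 0)) (at u)"
      by (intro tendsto_intros t)
    then show "((\<lambda>x. 2 * (\<Sum>b\<in>Basis. \<bar>\<rho> (d b) x\<bar> / norm (x - u))) \<longlongrightarrow> 0) (at u)" by simp
    show "eventually (\<lambda>x. norm (E x) / norm (x - u) \<le> 2 * (\<Sum>b\<in>Basis. \<bar>\<rho> (d b) x\<bar> / norm (x - u))) (at u)"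
      using eventually_conj[OF ev1 ev2]
    proof eventually_elim
      case (elim x)
      then have "norm (E x) / norm (x - u) \<le> 2 * (\<Sum>b\<in>Basis. \<bar>\<rho> (d b) x\<bar>) / norm (x - u)"
        by (intro divide_right_mono bound) auto
      then show ?case by (simp add: sum_divide_distrib[symmetric])
    qed
  qed (auto intro: tendsto_intros)
  have "(W has_derivative D) (at u)"
    unfolding has_derivative_iff_norm using blD E0 by (simp add: E_def)
  then show ?thesis unfolding differentiable_def by blast
qed

section \<open>Riemannian metrics in a chart\<close>

text \<open>Christoffel symbols of the first kind: the value of \<open>G u (levi_civita G u X Y) Z\<close>.\<close>

definition koszul :: "('e::euclidean_space \<Rightarrow> 'e \<Rightarrow> 'e \<Rightarrow> real) \<Rightarrow> 'e \<Rightarrow> 'e \<Rightarrow> 'e \<Rightarrow> 'e \<Rightarrow> real" where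
  "koszul G u X Y Z = (dir_deriv (\<lambda>u. G u Y Z) u X + dir_deriv (\<lambda>u. G u X Z) u Y
     - dir_deriv (\<lambda>u. G u X Y) u Z) / 2"

text \<open>Two continuous derivatives are what the symmetries of the curvature require.\<close>

locale riemannian_chart =
  fixes S :: "'e::euclidean_space set" and G :: "'e \<Rightarrow> 'e \<Rightarrow> 'e \<Rightarrow> real"
  assumes open_S: "open S"
    and C2: "\<And>v w. C2_on S (\<lambda>u. G u v w)"
    and bil: "\<And>u. u \<in> S \<Longrightarrow> bilinear (G u)"
    and sym: "\<And>u v w. u \<in> S \<Longrightarrow> G u v w = G u w v"
    and pos: "\<And>u v. u \<in> S \<Longrightarrow> v \<noteq> 0 \<Longrightarrow> G u v v > 0"
begin

abbreviation "\<Gamma> \<equiv> levi_civita G"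

lemma lin1: "u \<in> S \<Longrightarrow> linear (\<lambda>w. G u w z)"
  and lin2: "u \<in> S \<Longrightarrow> linear (G u w)"
  using bil by (auto simp: bilinear_def)

lemmas add1 = lin1[THEN linear_add] and add2 = lin2[THEN linear_add]
  and diff1 = lin1[THEN linear_diff] and diff2 = lin2[THEN linear_diff]
  and neg1 = lin1[THEN linear_neg] and neg2 = lin2[THEN linear_neg]
  and scale1 = lin1[THEN linear_cmul] and scale2 = lin2[THEN linear_cmul]

lemma nondegenerate: "u \<in> S \<Longrightarrow> (\<And>z. G u w z = G u w' z) \<Longrightarrow> w = w'"
  using posdef_nondegenerate[OF bil pos] by blast

lemma dG: "u \<in> S \<Longrightarrow> (\<lambda>u. G u v w) differentiable (at u)"
  and ddG: "u \<in> S \<Longrightarrow> (\<lambda>u. dir_deriv (\<lambda>u. G u v w) u x) differentiable (at u)"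
  using C2 by (auto simp: C2_on_def)

lemma DG_lin:
  assumes "u \<in> S"
  shows "linear (\<lambda>X. dir_deriv (\<lambda>u. G u Y Z) u X)" "linear (\<lambda>Y. dir_deriv (\<lambda>u. G u Y Z) u X)"
    "linear (\<lambda>Z. dir_deriv (\<lambda>u. G u Y Z) u X)"
  using linear_dir_deriv[OF dG[OF assms]]
    linear_dir_deriv_family[OF open_S assms, of "\<lambda>u Y. G u Y Z"]
    linear_dir_deriv_family[OF open_S assms, of "\<lambda>u. G u Y"] lin1 lin2 dG[OF assms]
  by auto

lemma DG_sym: "u \<in> S \<Longrightarrow> dir_deriv (\<lambda>u. G u Y Z) u X = dir_deriv (\<lambda>u. G u Z Y) u X"
  by (rule dir_deriv_cong[OF open_S _ sym])

lemma koszul_lin: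
  assumes "u \<in> S"
  shows "linear (\<lambda>X. koszul G u X Y Z)" "linear (\<lambda>Y. koszul G u X Y Z)" "linear (koszul G u X Y)"
proof -
  note L = DG_lin[OF assms]
  show "linear (\<lambda>X. koszul G u X Y Z)" "linear (\<lambda>Y. koszul G u X Y Z)" "linear (koszul G u X Y)"
    by (rule linearI; simp add: koszul_def L[THEN linear_add] L[THEN linear_cmul] field_simps)+
qed

lemma koszul_sym: "u \<in> S \<Longrightarrow> koszul G u X Y Z = koszul G u Y X Z"
  using DG_sym[of u X Y Z] by (simp add: koszul_def)

lemma koszul_compat: "u \<in> S \<Longrightarrow> koszul G u X Y Z + koszul G u X Z Y = dir_deriv (\<lambda>u. G u Y Z) u X"
  using DG_sym[of u Z Y X] by (simp add: koszul_def field_simps)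

lemma levi_civita_koszul:
  assumes u: "u \<in> S"
  shows "G u (\<Gamma> u X Y) Z = koszul G u X Y Z"
proof -
  obtain W where W: "\<And>Z. G u W Z = koszul G u X Y Z"
    using posdef_representation[OF bil[OF u] pos[OF u] koszul_lin(3)[OF u, of X Y]] by blast
  have "\<Gamma> u X Y = W"
    unfolding levi_civita_def
  proof (rule the_equality)
    show "\<forall>Z. 2 * G u W Z = dir_deriv (\<lambda>u. G u Y Z) u X + dir_deriv (\<lambda>u. G u X Z) u Y
        - dir_deriv (\<lambda>u. G u X Y) u Z"
      by (simp add: W koszul_def)
  next
    fix V assume "\<forall>Z. 2 * G u V Z = dir_deriv (\<lambda>u. G u Y Z) u X + dir_deriv (\<lambda>u. G u X Z) u Y
        - dir_deriv (\<lambda>u. G u X Y) u Z"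
    then have "2 * G u V Z = 2 * G u W Z" for Z by (simp add: W koszul_def)
    then have "G u V Z = G u W Z" for Z using mult_left_cancel[of 2] by simp
    then show "V = W" using nondegenerate[OF u] by blast
  qed
  then show ?thesis by (simp add: W)
qed

lemma levi_civita_sym: "u \<in> S \<Longrightarrow> \<Gamma> u X Y = \<Gamma> u Y X"
  using nondegenerate levi_civita_koszul koszul_sym by metis

lemma levi_civita_lin:
  assumes u: "u \<in> S"
  shows "linear (\<lambda>X. \<Gamma> u X Y)" "linear (\<Gamma> u X)"
proof -
  show 1: "linear (\<lambda>X. \<Gamma> u X Y)" for Y
    by (rule linearI; rule nondegenerate[OF u])
      (simp_all add: u levi_civita_koszul add1 scale1 koszul_lin(1)[THEN linear_add]
        koszul_lin(1)[THEN linear_cmul])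
  show "linear (\<Gamma> u X)"
    using 1[of X] by (simp add: levi_civita_sym[OF u, of X] linear_iff)
qed

lemma metric_compatible:
  "u \<in> S \<Longrightarrow> dir_deriv (\<lambda>u. G u Y Z) u X = G u (\<Gamma> u X Y) Z + G u Y (\<Gamma> u X Z)"
  using sym[of u Y "\<Gamma> u X Z"] by (simp add: levi_civita_koszul koszul_compat)

lemma koszul_differentiable: "u \<in> S \<Longrightarrow> (\<lambda>u. koszul G u X Y Z) differentiable (at u)"
  unfolding koszul_def by (intro derivative_intros ddG) auto

text \<open>The curvature tensor contains derivatives of the Christoffel symbols, which are given only as the
solution of the linear system \<open>levi_civita_koszul\<close>.\<close>

lemma levi_civita_differentiable: "u \<in> S \<Longrightarrow> (\<lambda>u. \<Gamma> u X Y) differentiable (at u)"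
  by (rule differentiable_implicit_linear[where G = G and K = "\<lambda>u. koszul G u X Y", OF open_S])
    (simp_all add: bil pos dG koszul_differentiable levi_civita_koszul, rule sym)

text \<open>Differentiate \<open>G u (\<Gamma> u Y Z) W = koszul G u Y Z W\<close> along \<open>X\<close>; by compatibility with the metric the
derivative of \<open>G\<close> supplies \<open>G u (\<Gamma> u X (\<Gamma> u Y Z)) W\<close>, the second term of the curvature, and the
correction \<open>G u (\<Gamma> u X W) (\<Gamma> u Y Z)\<close>.  No inverse of the metric appears.\<close>

lemma curvature_koszul:
  assumes u: "u \<in> S"
  shows "G u (curvature G u X Y Z) W =
    dir_deriv (\<lambda>u. koszul G u Y Z W) u X - dir_deriv (\<lambda>u. koszul G u X Z W) u Y
    - G u (\<Gamma> u X W) (\<Gamma> u Y Z) + G u (\<Gamma> u Y W) (\<Gamma> u X Z)"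
proof -
  have "G u (dir_deriv (\<lambda>u. \<Gamma> u Y Z) u X) W
      = dir_deriv (\<lambda>u. koszul G u Y Z W) u X - G u (\<Gamma> u X (\<Gamma> u Y Z)) W
        - G u (\<Gamma> u X W) (\<Gamma> u Y Z)" for X Y
  proof -
    have "dir_deriv (\<lambda>u. koszul G u Y Z W) u X = dir_deriv (\<lambda>u. G u (\<Gamma> u Y Z) W) u X"
      by (rule dir_deriv_cong[OF open_S u]) (simp add: levi_civita_koszul)
    also have "\<dots> = dir_deriv (\<lambda>x. G x (\<Gamma> u Y Z) W) u X + G u (dir_deriv (\<lambda>u. \<Gamma> u Y Z) u X) W"
      by (rule dir_deriv_linear_family[OF open_S u, where F = "\<lambda>x w. G x w W"])
        (use u in \<open>auto intro: lin1 dG levi_civita_differentiable\<close>)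
    finally show ?thesis
      using sym[OF u, of "\<Gamma> u Y Z" "\<Gamma> u X W"] by (simp add: metric_compatible u)
  qed
  then show ?thesis by (simp add: curvature_def u add1 diff1)
qed

lemma curvature_lin:
  assumes u: "u \<in> S"
  shows "linear (\<lambda>X. curvature G u X Y Z)" "linear (\<lambda>Y. curvature G u X Y Z)"
    "linear (\<lambda>Z. curvature G u X Y Z)"
proof -
  note d = levi_civita_differentiable[OF u] and g = levi_civita_lin[OF u]
  have 1: "linear (\<lambda>V. dir_deriv (\<lambda>u. \<Gamma> u Y Z) u V)" for Y Z
    by (rule linear_dir_deriv[OF d])
  have 2: "linear (\<lambda>V. dir_deriv (\<lambda>u. \<Gamma> u V Z) u X)" "linear (\<lambda>V. dir_deriv (\<lambda>u. \<Gamma> u Y V) u X)"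
    for X Y Z
    using linear_dir_deriv_family[OF open_S u, of "\<lambda>u V. \<Gamma> u V Z"]
      linear_dir_deriv_family[OF open_S u, of "\<lambda>u. \<Gamma> u Y"] levi_civita_lin d by auto
  show "linear (\<lambda>X. curvature G u X Y Z)" "linear (\<lambda>Y. curvature G u X Y Z)"
    "linear (\<lambda>Z. curvature G u X Y Z)"
    by (rule linearI; simp add: curvature_def 1[THEN linear_add] 1[THEN linear_cmul]
        2[THEN linear_add] 2[THEN linear_cmul] g[THEN linear_add] g[THEN linear_cmul] algebra_simps)+
qed

definition "R u X Y Z W = G u (curvature G u X Y Z) W"

lemma R_add:
  assumes "u \<in> S"
  shows "R u (X + X') Y Z W = R u X Y Z W + R u X' Y Z W"
    "R u X (Y + Y') Z W = R u X Y Z W + R u X Y' Z W"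
    "R u X Y (Z + Z') W = R u X Y Z W + R u X Y Z' W"
    "R u X Y Z (W + W') = R u X Y Z W + R u X Y Z W'"
  by (simp_all add: R_def curvature_lin[OF assms, THEN linear_add] add1 add2 assms)

lemma R_skew12: "u \<in> S \<Longrightarrow> R u X Y Z W = - R u Y X Z W"
  by (simp add: R_def curvature_koszul)

text \<open>Symmetrizing \<open>koszul G u Y Z W\<close> in \<open>Z\<close> and \<open>W\<close> gives the derivative of \<open>G u Z W\<close> along \<open>Y\<close>, so the
symmetrized second-order part of the curvature is a commutator of second derivatives of \<open>G\<close>.\<close>

lemma R_skew34:
  assumes u: "u \<in> S"
  shows "R u X Y Z W = - R u X Y W Z"
proof -
  have "dir_deriv (\<lambda>u. koszul G u Y Z W) u X + dir_deriv (\<lambda>u. koszul G u Y W Z) u X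
     = dir_deriv (\<lambda>u. dir_deriv (\<lambda>u. G u Z W) u Y) u X" for X Y
  proof -
    have "dir_deriv (\<lambda>u. koszul G u Y Z W) u X + dir_deriv (\<lambda>u. koszul G u Y W Z) u X
       = dir_deriv (\<lambda>u. koszul G u Y Z W + koszul G u Y W Z) u X"
      using koszul_differentiable[OF u] by (simp add: dir_deriv_add)
    also have "\<dots> = dir_deriv (\<lambda>u. dir_deriv (\<lambda>u. G u Z W) u Y) u X"
      by (rule dir_deriv_cong[OF open_S u]) (simp add: koszul_compat)
    finally show ?thesis .
  qed
  from this[of X Y] this[of Y X]
    dir_deriv_commute[OF open_S u C2, of Z W X Y] show ?thesis
    using sym[OF u] unfolding R_def curvature_koszul[OF u]
    by (smt (verit) sym[OF u])
qed

lemma R_bianchi: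
  assumes u: "u \<in> S"
  shows "R u X Y Z W + R u Y Z X W + R u Z X Y W = 0"
proof -
  have s: "dir_deriv (\<lambda>u. \<Gamma> u Y Z) u X = dir_deriv (\<lambda>u. \<Gamma> u Z Y) u X" for X Y Z
    by (rule dir_deriv_cong[OF open_S u levi_civita_sym])
  have "curvature G u X Y Z + curvature G u Y Z X + curvature G u Z X Y = 0"
    unfolding curvature_def
    by (simp add: s[of _ Z Y] s[of _ Y X] s[of _ X Z]
        levi_civita_sym[OF u, of Z Y] levi_civita_sym[OF u, of Y X] levi_civita_sym[OF u, of X Z])
  then have "G u (curvature G u X Y Z + curvature G u Y Z X + curvature G u Z X Y) W = 0"
    using linear_0[OF lin1[OF u]] by simp
  then show ?thesis by (simp add: R_def add1 u)
qed

end

section \<open>Algebraic curvature identities\<close>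

lemma curvature_pair_symmetric:
  fixes R :: "'a \<Rightarrow> 'a \<Rightarrow> 'a \<Rightarrow> 'a \<Rightarrow> real"
  assumes skew12: "\<And>x y z w. R x y z w = - R y x z w"
    and skew34: "\<And>x y z w. R x y z w = - R x y w z"
    and bianchi: "\<And>x y z w. R x y z w + R y z x w + R z x y w = 0"
  shows "R x y z w = R z w x y"
  using bianchi[of x y z w] bianchi[of y z w x] bianchi[of z w x y] bianchi[of w x y z]
    skew12[of x y] skew12[of x z] skew12[of x w] skew12[of y z] skew12[of y w] skew12[of z w]
    skew34[of _ _ x y] skew34[of _ _ x z] skew34[of _ _ x w] skew34[of _ _ y z] skew34[of _ _ y w]
    skew34[of _ _ z w]
  by (smt (verit, best))

text \<open>Expanding \<open>H (x + y) + H (x - y)\<close> leaves the six terms of degree two in \<open>y\<close>.  By \<open>J\<close>-invariance in both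
pairs of slots and the Bianchi identity they reduce to \<open>R x y y x\<close> and \<open>R x (J y) (J y) x\<close>.  Replacing \<open>y\<close>
by \<open>J y\<close> exchanges the two, so that the identity is in fact a pair of linear equations for them.\<close>

lemma kaehler_polarization:
  fixes R :: "'a::ab_group_add \<Rightarrow> 'a \<Rightarrow> 'a \<Rightarrow> 'a \<Rightarrow> real"
  assumes add1: "\<And>x x' y z w. R (x + x') y z w = R x y z w + R x' y z w"
    and add2: "\<And>x y y' z w. R x (y + y') z w = R x y z w + R x y' z w"
    and add3: "\<And>x y z z' w. R x y (z + z') w = R x y z w + R x y z' w"
    and add4: "\<And>x y z w w'. R x y z (w + w') = R x y z w + R x y z w'"
    and skew12: "\<And>x y z w. R x y z w = - R y x z w"
    and skew34: "\<And>x y z w. R x y z w = - R x y w z"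
    and bianchi: "\<And>x y z w. R x y z w + R y z x w + R z x y w = 0"
    and J: "\<And>x y z w. R x y (J z) (J w) = R x y z w"
    and J_add: "\<And>x y. J (x + y) = J x + J y" and J_J: "\<And>x. J (J x) = - x"
  defines "H \<equiv> \<lambda>x. R x (J x) (J x) x"
  shows "H (x + y) + H (x - y) = 2 * H x + 2 * H y + 4 * R x y y x + 12 * R x (J y) (J y) x"
proof -
  have pair: "R x y z w = R z w x y" for x y z w
    by (rule curvature_pair_symmetric[OF skew12 skew34 bianchi])
  have J12: "R (J x) (J y) z w = R x y z w" for x y z w
    using J[of z w x y] by (simp add: pair[of _ _ z w])
  have J0: "J 0 = 0" using J_add[of 0 0] by simp
  have J_neg: "J (- x) = - J x" for x using J_add[of x "- x"] J0 by (simp add: eq_neg_iff_add_eq_0 add.commute)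
  have R0: "R 0 y z w = 0" "R x 0 z w = 0" "R x y 0 w = 0" "R x y z 0 = 0" for x y z w
    using add1[of 0 0] add2[of _ 0 0] add3[of _ _ 0 0] add4[of _ _ _ 0 0] by auto
  have neg1: "R (- x) y z w = - R x y z w" for x y z w using add1[of x "- x" y z w] R0 by simp
  have neg2: "R x (- y) z w = - R x y z w" for x y z w using add2[of x y "- y" z w] R0 by simp
  have neg3: "R x y (- z) w = - R x y z w" for x y z w using add3[of x y z "- z" w] R0 by simp
  have neg4: "R x y z (- w) = - R x y z w" for x y z w using add4[of x y z w "- w"] R0 by simp
  have "H (x + y) + H (x + (- y)) = 2 * H x + 2 * H y
     + 2 * (R x (J x) (J y) y + R x (J y) (J x) y + R y (J x) (J x) y
       + R x (J y) (J y) x + R y (J x) (J y) x + R y (J y) (J x) x)"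
    unfolding H_def J_add J_neg add1 add2 add3 add4 neg1 neg2 neg3 neg4 by simp
  moreover have mixed: "R x (J y) (J x) y = R x (J y) (J y) x"
    "R y (J x) (J x) y = R x (J y) (J y) x" "R y (J x) (J y) x = R x (J y) (J y) x"
  proof -
    have s: "R a (J b) z w = R b (J a) z w" for a b z w
      using J12[of a "J b" z w] skew12[of "J a" b z w] by (simp add: J_J neg2)
    have s': "R z w (J a) b = R z w (J b) a" for a b z w
      using s[of b a z w] pair[of z w "J a" b] pair[of z w "J b" a] skew12 by (metis)
    show "R x (J y) (J x) y = R x (J y) (J y) x" by (rule s')
    show "R y (J x) (J y) x = R x (J y) (J y) x" by (rule s)
    show "R y (J x) (J x) y = R x (J y) (J y) x" using s s' by metis
  qed
  moreover have "R x (J x) (J y) y = R x y y x + R x (J y) (J y) x"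
  proof -
    have "R (J x) (J y) x y = - R x y y x" using J12 skew34 by metis
    moreover have "R (J y) x (J x) y = - R x (J y) (J y) x" using skew12 mixed(1) by metis
    ultimately show ?thesis using bianchi[of x "J x" "J y" y] by simp
  qed
  moreover have "R y (J y) (J x) x = R x (J x) (J y) y"
    using pair[of y "J y" "J x" x] pair[of x "J x" "J y" y] skew12 skew34 by metis
  ultimately show ?thesis by simp
qed

section \<open>Kaehler metrics in a chart\<close>

locale kaehler_chart = riemannian_chart S G for S and G :: "'e::euclidean_space \<Rightarrow> 'e \<Rightarrow> 'e \<Rightarrow> real" +
  fixes J :: "'e \<Rightarrow> 'e \<Rightarrow> 'e"
  assumes J_C2: "\<And>v. C2_on S (\<lambda>u. J u v)"
    and J_lin: "\<And>u. u \<in> S \<Longrightarrow> linear (J u)"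
    and J_J: "\<And>u v. u \<in> S \<Longrightarrow> J u (J u v) = - v"
    and J_isometry: "\<And>u v w. u \<in> S \<Longrightarrow> G u (J u v) (J u w) = G u v w"
    and integrable: "\<And>u X Y. u \<in> S \<Longrightarrow> nijenhuis J u X Y = 0"
    and closed: "closed_2form (fundamental_form G J) S"
begin

lemmas J_add = J_lin[THEN linear_add] and J_diff = J_lin[THEN linear_diff]

lemma dJ: "u \<in> S \<Longrightarrow> (\<lambda>u. J u v) differentiable (at u)"
  using J_C2 by (auto simp: C2_on_def)

lemma J_skew: "u \<in> S \<Longrightarrow> G u (J u v) w = - G u v (J u w)"
  using J_isometry[of u "J u v" w] J_J[of u v] by (simp add: neg1)

definition "nabla_J u X Y = dir_deriv (\<lambda>u. J u Y) u X + \<Gamma> u X (J u Y) - J u (\<Gamma> u X Y)"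

lemma dir_deriv_J_family:
  assumes u: "u \<in> S" and W: "W differentiable (at u)"
  shows "dir_deriv (\<lambda>u. J u (W u)) u X = dir_deriv (\<lambda>x. J x (W u)) u X + J u (dir_deriv W u X)"
    "(\<lambda>u. J u (W u)) differentiable (at u)"
  using dir_deriv_linear_family[OF open_S u, where F = J and W = W] differentiable_linear_family[OF open_S u, where F = J and W = W]
    J_lin dJ[OF u] W by auto

lemma nabla_J_anticommute:
  assumes u: "u \<in> S"
  shows "nabla_J u X (J u Y) = - J u (nabla_J u X Y)"
proof -
  have "dir_deriv (\<lambda>x. J x (J x Y)) u X = dir_deriv (\<lambda>x. - Y) u X"
    by (rule dir_deriv_cong[OF open_S u]) (rule J_J)
  then have "dir_deriv (\<lambda>x. J x (J u Y)) u X + J u (dir_deriv (\<lambda>u. J u Y) u X) = 0"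
    using dir_deriv_J_family(1)[OF u dJ[OF u], of Y X] by (simp add: dir_deriv_const)
  then show ?thesis
    using levi_civita_lin(2)[OF u, THEN linear_neg]
    by (simp add: nabla_J_def J_J u J_add J_diff eq_neg_iff_add_eq_0 algebra_simps)
qed

lemma dir_deriv_fundamental_form:
  assumes u: "u \<in> S"
  shows "dir_deriv (\<lambda>u. fundamental_form G J u Y Z) u X =
    G u (\<Gamma> u X Y) (J u Z) - G u (\<Gamma> u X Z) (J u Y) + G u (nabla_J u X Z) Y"
proof -
  have "dir_deriv (\<lambda>u. G u Y (J u Z)) u X
      = dir_deriv (\<lambda>x. G x Y (J u Z)) u X + G u Y (dir_deriv (\<lambda>u. J u Z) u X)"
    by (rule dir_deriv_linear_family[OF open_S u, where F = "\<lambda>x. G x Y"])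
      (use u in \<open>auto intro: lin2 dG dJ\<close>)
  then show ?thesis
    using J_skew[OF u, of "\<Gamma> u X Z" Y]
    by (simp add: fundamental_form_def metric_compatible u nabla_J_def add1 add2 diff1 diff2
        sym[OF u, of _ Y])
qed

lemma nabla_J_skew:
  assumes u: "u \<in> S"
  shows "G u (nabla_J u X Y) Z = - G u (nabla_J u X Z) Y"
proof -
  have "dir_deriv (\<lambda>u. fundamental_form G J u Y Z) u X
      = dir_deriv (\<lambda>u. - fundamental_form G J u Z Y) u X"
    by (rule dir_deriv_cong[OF open_S u])
      (use J_skew sym in \<open>metis fundamental_form_def\<close>)
  moreover have "(\<lambda>u. fundamental_form G J u Z Y) differentiable (at u)"
    unfolding fundamental_form_def
    by (rule differentiable_linear_family[OF open_S u, where F = "\<lambda>x. G x Z"])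
      (use u in \<open>auto intro: lin2 dG dJ\<close>)
  ultimately have "dir_deriv (\<lambda>u. fundamental_form G J u Y Z) u X
      = - dir_deriv (\<lambda>u. fundamental_form G J u Z Y) u X"
    using dir_deriv_cmult[of "\<lambda>u. fundamental_form G J u Z Y" u "-1" X] by simp
  then show ?thesis by (simp add: dir_deriv_fundamental_form u)
qed

text \<open>Since the connection is torsion-free, the Christoffel symbols drop out of the exterior derivative, and
closedness becomes a cyclic identity for \<open>nabla_J\<close>; the same happens to the Nijenhuis tensor in
the next lemma.\<close>

lemma nabla_J_closed:
  assumes u: "u \<in> S"
  shows "G u (nabla_J u X Z) Y + G u (nabla_J u Y X) Z + G u (nabla_J u Z Y) X = 0"
proof -
  have "dir_deriv (\<lambda>u. fundamental_form G J u Y Z) u X + dir_deriv (\<lambda>u. fundamental_form G J u Z X) u Y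
     + dir_deriv (\<lambda>u. fundamental_form G J u X Y) u Z = 0"
    using closed u by (simp add: closed_2form_def)
  then show ?thesis
    by (simp add: dir_deriv_fundamental_form u levi_civita_sym[OF u, of Y X]
      levi_civita_sym[OF u, of Z X] levi_civita_sym[OF u, of Z Y])
qed

lemma nabla_J_integrable:
  assumes u: "u \<in> S"
  shows "nabla_J u (J u Y) Z - nabla_J u (J u Z) Y = J u (nabla_J u Y Z - nabla_J u Z Y)"
proof -
  have "nijenhuis J u Y Z = nabla_J u (J u Y) Z - nabla_J u (J u Z) Y - J u (nabla_J u Y Z - nabla_J u Z Y)"
    by (simp add: nijenhuis_def nabla_J_def J_add J_diff J_J u levi_civita_sym[OF u, of Z Y]
       levi_civita_sym[OF u, of "J u Z" "J u Y"] levi_civita_sym[OF u, of "J u Z" Y]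
       levi_civita_sym[OF u, of "J u Y" Z])
  then show ?thesis using integrable[OF u] by simp
qed

text \<open>Write \<open>?c X Y Z\<close> for \<open>G u (nabla_J u X Y) Z\<close>.  In the closedness identity for \<open>X, Y, Z\<close> minus the one for
\<open>X, J Y, J Z\<close> the terms with \<open>X\<close> in the first slot add up to \<open>2 * ?c X Z Y\<close>, because \<open>nabla_J\<close> anticommutes
with \<open>J\<close>; all other terms cancel by integrability paired with \<open>J X\<close>.\<close>

lemma nabla_J_zero:
  assumes u: "u \<in> S"
  shows "nabla_J u X Y = 0"
proof -
  let ?c = "\<lambda>X Y Z. G u (nabla_J u X Y) Z"
  have JJ: "?c X (J u Y) (J u Z) = - ?c X Y Z" for X Y Z
    by (simp add: nabla_J_anticommute u neg1 J_isometry)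
  have J1: "?c X (J u Y) Z = ?c X Y (J u Z)" for X Y Z
    by (simp add: nabla_J_anticommute u neg1 J_skew)
  have "?c X Z Y = 0" for Z
  proof -
    have "?c (J u Y) Z (J u X) - ?c (J u Z) Y (J u X) = ?c Y Z X - ?c Z Y X"
      using arg_cong[OF nabla_J_integrable[OF u, of Y Z], of "\<lambda>V. G u V (J u X)"]
      by (simp add: J_isometry u diff1)
    moreover have "?c X (J u Z) (J u Y) + ?c (J u Y) X (J u Z) + ?c (J u Z) (J u Y) X = 0"
      by (rule nabla_J_closed[OF u])
    moreover have "?c X Z Y + ?c Y X Z + ?c Z Y X = 0" by (rule nabla_J_closed[OF u])
    moreover have "?c (J u Y) X (J u Z) = - ?c (J u Y) Z (J u X)"
      using nabla_J_skew[OF u] J1 by metis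
    moreover have "?c Y X Z = - ?c Y Z X" by (rule nabla_J_skew[OF u])
    ultimately show ?thesis using JJ[of X Z Y] J1[of "J u Z" Y X] by linarith
  qed
  then have "G u (nabla_J u X Y) Z = G u 0 Z" for Z
    using nabla_J_skew[OF u] linear_0[OF lin1[OF u]] by (metis neg_0_equal_iff_equal)
  then show ?thesis by (rule nondegenerate[OF u])
qed

lemma dir_deriv_J: "u \<in> S \<Longrightarrow> dir_deriv (\<lambda>u. J u Y) u X = J u (\<Gamma> u X Y) - \<Gamma> u X (J u Y)"
  using nabla_J_zero[of u X Y] by (simp add: nabla_J_def algebra_simps eq_diff_eq)

text \<open>Differentiate \<open>\<nabla>J = 0\<close>, in the form \<open>dir_deriv_J\<close>, once more and antisymmetrize: the second
derivatives of \<open>J\<close> commute, and the first derivatives of \<open>J\<close> are replaced by Christoffel symbols by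
means of \<open>dir_deriv_J\<close> again.\<close>

lemma curvature_J:
  assumes u: "u \<in> S"
  shows "curvature G u X Y (J u Z) = J u (curvature G u X Y Z)"
proof -
  have "dir_deriv (\<lambda>x. \<Gamma> x X (J u Z)) u Y =
     dir_deriv (\<lambda>x. J x (\<Gamma> u X Z)) u Y + J u (dir_deriv (\<lambda>u. \<Gamma> u X Z) u Y)
     - \<Gamma> u X (dir_deriv (\<lambda>u. J u Z) u Y) - dir_deriv (\<lambda>x. dir_deriv (\<lambda>u. J u Z) x X) u Y" for X Y
  proof -
    have dd: "(\<lambda>x. J x (\<Gamma> x X Z)) differentiable (at u)"
      "(\<lambda>x. \<Gamma> x X (J x Z)) differentiable (at u)"
      using dir_deriv_J_family(2) differentiable_linear_family[OF open_S u, of "\<lambda>x. \<Gamma> x X"]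
        levi_civita_lin(2) levi_civita_differentiable u dJ by auto
    have "dir_deriv (\<lambda>x. dir_deriv (\<lambda>u. J u Z) x X) u Y
        = dir_deriv (\<lambda>x. J x (\<Gamma> x X Z) - \<Gamma> x X (J x Z)) u Y"
      by (rule dir_deriv_cong[OF open_S u]) (rule dir_deriv_J)
    also have "\<dots> = dir_deriv (\<lambda>x. J x (\<Gamma> x X Z)) u Y - dir_deriv (\<lambda>x. \<Gamma> x X (J x Z)) u Y"
      by (rule dir_deriv_diff[OF dd])
    also have "dir_deriv (\<lambda>x. J x (\<Gamma> x X Z)) u Y
        = dir_deriv (\<lambda>x. J x (\<Gamma> u X Z)) u Y + J u (dir_deriv (\<lambda>u. \<Gamma> u X Z) u Y)"
      by (rule dir_deriv_J_family(1)[OF u levi_civita_differentiable[OF u]])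
    also have "dir_deriv (\<lambda>x. \<Gamma> x X (J x Z)) u Y
        = dir_deriv (\<lambda>x. \<Gamma> x X (J u Z)) u Y + \<Gamma> u X (dir_deriv (\<lambda>u. J u Z) u Y)"
      by (rule dir_deriv_linear_family[OF open_S u, where F = "\<lambda>x. \<Gamma> x X"])
        (use u in \<open>auto intro: levi_civita_lin levi_civita_differentiable dJ\<close>)
    finally show ?thesis by simp
  qed
  note * = this
  show ?thesis
    unfolding curvature_def *
    using dir_deriv_commute[OF open_S u J_C2, of Z X Y]
    by (simp add: dir_deriv_J u J_add J_diff levi_civita_lin(2)[OF u, THEN linear_diff])
qed

lemma R_J: "u \<in> S \<Longrightarrow> R u X Y (J u Z) (J u W) = R u X Y Z W"
  by (simp add: R_def curvature_J J_isometry)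

lemma J_orthogonal: "u \<in> S \<Longrightarrow> G u X (J u X) = 0"
  using J_skew[of u X X] sym[of u X "J u X"] by simp

lemma holomorphic_R:
  assumes u: "u \<in> S" and H: "\<And>X. X \<noteq> 0 \<Longrightarrow> sectional_curvature G u X (J u X) = k"
  shows "R u X (J u X) (J u X) X = k * (G u X X)\<^sup>2"
proof (cases "X = 0")
  case True
  then show ?thesis using linear_0[OF lin2[OF u]] by (simp add: R_def)
next
  case False
  then have "G u X X \<noteq> 0" using pos[OF u, of X] by simp
  then show ?thesis
    using H[OF False]
    by (simp add: sectional_curvature_def R_def J_isometry u J_orthogonal field_simps power2_eq_square)
qed

text \<open>The polarization identity for \<open>(X, Y)\<close> and for \<open>(X, J Y)\<close> has the same left-hand side, because
\<open>X\<close> is orthogonal to both \<open>Y\<close> and \<open>J Y\<close>.  Solving the two equations gives the mixed curvature.\<close>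

lemma constant_holomorphic_imp_mixed:
  assumes u: "u \<in> S" and H: "\<And>X. X \<noteq> 0 \<Longrightarrow> sectional_curvature G u X (J u X) = k"
    and orth: "G u X Y = 0" "G u X (J u Y) = 0"
  shows "4 * R u X (J u Y) (J u Y) X = k * G u X X * G u Y Y"
proof -
  note h = holomorphic_R[OF u H]
  note pol = kaehler_polarization[of "R u" "J u", OF R_add[OF u] R_skew12[OF u] R_skew34[OF u]
      R_bianchi[OF u] R_J[OF u] J_add[OF u] J_J[OF u]]
  have s: "R u x (- y) (- y) x = R u x y y x" for x y
    by (simp add: R_def curvature_lin(2,3)[OF u, THEN linear_neg] neg1[OF u])
  have n: "k * (G u (X + Y) (X + Y))\<^sup>2 + k * (G u (X - Y) (X - Y))\<^sup>2
      = 2 * k * (G u X X + G u Y Y)\<^sup>2" if "G u X Y = 0" for X Y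
    using that sym[OF u, of Y X] by (simp add: add1 add2 diff1 diff2 u)
  have "2 * k * (G u X X + G u Y Y)\<^sup>2 = 2 * (k * (G u X X)\<^sup>2) + 2 * (k * (G u Y Y)\<^sup>2)
     + 4 * R u X Y Y X + 12 * R u X (J u Y) (J u Y) X"
    using pol[of X Y] n[OF orth(1)] by (simp add: h)
  moreover have "2 * k * (G u X X + G u Y Y)\<^sup>2 = 2 * (k * (G u X X)\<^sup>2) + 2 * (k * (G u Y Y)\<^sup>2)
     + 4 * R u X (J u Y) (J u Y) X + 12 * R u X Y Y X"
    using pol[of X "J u Y"] n[OF orth(2)] h[of "J u Y"] by (simp add: h J_J u J_isometry s)
  ultimately show ?thesis by (simp add: power2_eq_square algebra_simps)
qed

end

section \<open>Linear forms, frames and one-variable limits\<close>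

text \<open>The vector that represents a linear form with respect to the standard inner product; covectors of the
base are encoded as such vectors.\<close>

definition covector :: "('e::euclidean_space \<Rightarrow> real) \<Rightarrow> 'e" where
  "covector \<phi> = (\<Sum>b\<in>Basis. \<phi> b *\<^sub>R b)"

lemma covector_inner:
  assumes "linear \<phi>" shows "covector \<phi> \<bullet> w = \<phi> w"
proof -
  have "covector \<phi> \<bullet> w = (\<Sum>b\<in>Basis. \<phi> b * (b \<bullet> w))" by (simp add: covector_def inner_sum_left)
  then show ?thesis
    using linear_euclidean_expand[OF assms, of w] by (simp add: inner_commute mult.commute)
qed

lemma vec_expand: "a = (\<Sum>i\<in>UNIV. a $ i *\<^sub>R axis i (1::real))"
  using basis_expansion[of a] by (simp add: scalar_mult_eq_scaleR)

lemma bilinear_expand: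
  fixes B :: "'v::real_vector \<Rightarrow> 'v \<Rightarrow> real" and a a' :: "real ^ 'n"
  assumes "bilinear B"
  shows "B (\<Sum>i\<in>UNIV. a $ i *\<^sub>R f i) (\<Sum>j\<in>UNIV. a' $ j *\<^sub>R f j)
    = (\<Sum>i\<in>UNIV. \<Sum>j\<in>UNIV. a $ i * a' $ j * B (f i) (f j))"
  using assms
  by (simp add: bilinear_sum sum.cartesian_product bilinear_lmul bilinear_rmul mult.assoc)

text \<open>Reads off a second derivative at 0 from a quadratic expansion whose coefficient \<open>\<psi>\<close> is merely
continuous: L'Hopital's rule turns the limit of \<open>\<phi>' s / s\<close> into the limit of \<open>\<psi>\<close>.  It is applied to a
coefficient that contains \<open>\<lambda>\<close> at the energy.\<close>

lemma lhopital_second_order: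
  fixes \<phi> \<phi>' \<psi> :: "real \<Rightarrow> real"
  assumes d: "\<And>s. (\<phi> has_real_derivative \<phi>' s) (at s)"
    and dd: "(\<phi>' has_real_derivative m) (at 0)" and "\<phi>' 0 = 0"
    and eq: "\<And>s. \<phi> s = k + s\<^sup>2 * \<psi> s"
    and \<psi>: "(\<psi> \<longlongrightarrow> \<psi> 0) (at_right 0)"
  shows "m = 2 * \<psi> 0"
proof -
  have k: "\<phi> 0 = k" using eq[of 0] by simp
  have "((\<lambda>s. (\<phi> s - k) / s\<^sup>2) \<longlongrightarrow> m / 2) (at_right 0)"
  proof (rule lhopital_right[where f' = \<phi>' and g' = "\<lambda>s. 2 * s"])
    have "(\<phi> \<longlongrightarrow> \<phi> 0) (at 0)" using DERIV_isCont[OF d[of 0]] by (simp add: isCont_def)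
    from tendsto_within_subset[OF this subset_UNIV]
    have "((\<lambda>s. \<phi> s - k) \<longlongrightarrow> \<phi> 0 - k) (at_right 0)" by (intro tendsto_intros)
    then show "((\<lambda>s. \<phi> s - k) \<longlongrightarrow> 0) (at_right 0)" by (simp add: k)
    have "((\<lambda>s::real. s\<^sup>2) \<longlongrightarrow> 0\<^sup>2) (at_right 0)" by (intro tendsto_intros)
    then show "((\<lambda>s::real. s\<^sup>2) \<longlongrightarrow> 0) (at_right 0)" by simp
    show "\<forall>\<^sub>F x in at_right 0. (x::real)\<^sup>2 \<noteq> 0" "\<forall>\<^sub>F x in at_right 0. 2 * (x::real) \<noteq> 0"
      by (auto simp: eventually_at_filter)
    show "\<forall>\<^sub>F x in at_right 0. ((\<lambda>s. \<phi> s - k) has_real_derivative \<phi>' x) (at x)"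
      by (intro always_eventually allI) (auto intro!: derivative_eq_intros d)
    show "\<forall>\<^sub>F x in at_right 0. ((\<lambda>s::real. s\<^sup>2) has_real_derivative 2 * x) (at x)"
      by (intro always_eventually allI) (auto intro!: derivative_eq_intros)
    have "((\<lambda>s. \<phi>' s / s) \<longlongrightarrow> m) (at 0)"
      using dd \<open>\<phi>' 0 = 0\<close> by (simp add: DERIV_def)
    from tendsto_within_subset[OF this subset_UNIV]
    have "((\<lambda>s. \<phi>' s / s / 2) \<longlongrightarrow> m / 2) (at_right 0)" by (intro tendsto_intros) auto
    then show "((\<lambda>s. \<phi>' s / (2 * s)) \<longlongrightarrow> m / 2) (at_right 0)" by (simp add: mult.commute)
  qed
  moreover have "\<forall>\<^sub>F s in at_right 0. (\<phi> s - k) / s\<^sup>2 = \<psi> s"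
    by (auto simp: eventually_at_filter eq)
  ultimately have "(\<psi> \<longlongrightarrow> m / 2) (at_right 0)"
    using filterlim_cong[of _ _ _ _ "\<lambda>s. (\<phi> s - k) / s\<^sup>2" \<psi>] by simp
  then have "m / 2 = \<psi> 0" using \<psi> tendsto_unique trivial_limit_at_right_real by blast
  then show ?thesis by simp
qed

lemma even_imp_derivative_zero:
  fixes \<phi> :: "real \<Rightarrow> real"
  assumes d: "(\<phi> has_real_derivative m) (at 0)" and even: "\<And>s. \<phi> (- s) = \<phi> s"
  shows "m = 0"
proof -
  have "((\<lambda>s. \<phi> (- s)) has_real_derivative m * (- 1)) (at 0)"
    by (rule DERIV_chain2[of \<phi>]) (use d in \<open>auto intro!: derivative_eq_intros\<close>)
  then have "(\<phi> has_real_derivative - m) (at 0)" by (simp add: even)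
  from DERIV_unique[OF d this] show ?thesis by simp
qed

lemma dir_deriv_zero_section:
  fixes f :: "'e::euclidean_space \<times> 'e \<Rightarrow> 'b::real_normed_vector"
  assumes "f differentiable (at (q, 0))"
  shows "dir_deriv (\<lambda>x. f (x, 0)) q a = dir_deriv f (q, 0) (a, 0)"
    "(\<lambda>x. f (x, 0)) differentiable (at q)"
proof -
  have l: "((\<lambda>x::'e. (x, 0::'e)) has_derivative (\<lambda>v. (v, 0))) (at q)"
    by (auto intro!: derivative_eq_intros)
  have "((\<lambda>x. f (x, 0)) has_derivative (\<lambda>v. dir_deriv f (q, 0) (v, 0))) (at q)"
    using has_derivative_compose[OF l has_derivative_dir_deriv[OF assms]] .
  then show "dir_deriv (\<lambda>x. f (x, 0)) q a = dir_deriv f (q, 0) (a, 0)"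
    "(\<lambda>x. f (x, 0)) differentiable (at q)"
    by (auto intro: dir_deriv_eqI simp: differentiable_def)
qed

lemma has_real_derivative_along_fiber:
  fixes f :: "'e::euclidean_space \<times> 'e \<Rightarrow> real"
  assumes "f differentiable (at (q, s *\<^sub>R b))"
  shows "((\<lambda>t. f (q, t *\<^sub>R b)) has_real_derivative dir_deriv f (q, s *\<^sub>R b) (0, b)) (at s)"
  using has_real_derivative_along_line[of f "(q, 0)" s "(0, b)"] assms by simp

section \<open>The metric of the cotangent bundle in an induced chart\<close>

text \<open>The local expression \<open>F\<close> of the metric of the cotangent bundle in an induced chart, \<open>g\<close> being the
one of the base.\<close>

locale cotangent_metric =
  base: riemannian_chart S g + total: riemannian_chart "S \<times> UNIV" F
  for S :: "(real ^ 'n) set" and g :: "'n local_metric"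
    and F :: "(real ^ 'n) \<times> (real ^ 'n) \<Rightarrow> (real ^ 'n) \<times> (real ^ 'n) \<Rightarrow> (real ^ 'n) \<times> (real ^ 'n) \<Rightarrow> real" +
  fixes A c :: real and lam :: "real \<Rightarrow> real"
  assumes A_pos: "A > 0" and lam_pos: "\<And>t. t \<ge> 0 \<Longrightarrow> lam t > 0"
    and lam_cont: "continuous_on {0..} lam"
    and horizontal: "\<And>q p i j. q \<in> S \<Longrightarrow>
      F (q, p) (delta_q g q p i) (delta_q g q p j) = G_qq A c lam g q p i j"
    and vertical: "\<And>q p i j. q \<in> S \<Longrightarrow>
      F (q, p) (partial_p i) (partial_p j) = G_pp A c lam g q p i j"
    and mixed: "\<And>q p i j. q \<in> S \<Longrightarrow> F (q, p) (partial_p i) (delta_q g q p j) = 0"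
begin

text \<open>\<open>conn q p a\<close> is the vertical component of the horizontal lift of \<open>a\<close> at \<open>(q, p)\<close>, that is, the
covector \<open>p\<^sub>k \<Gamma>\<^sup>k\<^sub>i\<^sub>h a\<^sup>i\<close>, and \<open>gsup\<close> is the dual metric on covectors.\<close>

definition "flat q v = covector (g q v)"
definition "conn q p a = covector (\<lambda>w. p \<bullet> base.\<Gamma> q a w)"
definition "gsup q b b' = (\<Sum>i\<in>UNIV. \<Sum>j\<in>UNIV. upper g q i j * b $ i * b' $ j)"

lemma flat_inner: "q \<in> S \<Longrightarrow> flat q v \<bullet> w = g q v w"
  by (simp add: flat_def covector_inner base.lin2)

lemma conn_inner: "q \<in> S \<Longrightarrow> conn q p a \<bullet> w = p \<bullet> base.\<Gamma> q a w"
  unfolding conn_def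
  by (rule covector_inner)
    (rule linearI; simp add: base.levi_civita_lin(2)[THEN linear_add] base.levi_civita_lin(2)[THEN linear_cmul] inner_add_right)

lemma conn_lin: "q \<in> S \<Longrightarrow> linear (conn q p)"
  by (rule linearI; rule vector_eq_rdot[THEN iffD1])
    (simp_all add: conn_inner inner_add_left inner_add_right base.levi_civita_lin(1)[THEN linear_add]
      base.levi_civita_lin(1)[THEN linear_cmul])

lemma conn_scale: "q \<in> S \<Longrightarrow> conn q (r *\<^sub>R p) a = r *\<^sub>R conn q p a"
  by (rule vector_eq_rdot[THEN iffD1]) (simp add: conn_inner)

lemma conn_component: "q \<in> S \<Longrightarrow> conn q p a $ h = p \<bullet> base.\<Gamma> q a (axis h 1)"
  using cart_eq_inner_axis[of "conn q p a" h] conn_inner[of q p a "axis h 1"] by simp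

lemma delta_q_conn: "q \<in> S \<Longrightarrow> delta_q g q p i = (axis i 1, conn q p (axis i 1))"
  unfolding delta_q_def
  by (simp add: vec_eq_iff conn_component christoffel_def inner_vec_def)

lemma frame_expand:
  "q \<in> S \<Longrightarrow> (a, conn q p a) = (\<Sum>i\<in>UNIV. a $ i *\<^sub>R delta_q g q p i)"
  "(0, b) = (\<Sum>i\<in>UNIV. b $ i *\<^sub>R partial_p i)"
proof -
  assume q: "q \<in> S"
  have "conn q p a = (\<Sum>i\<in>UNIV. a $ i *\<^sub>R conn q p (axis i 1))"
    using arg_cong[OF vec_expand[of a], of "conn q p"]
    by (simp add: linear_sum[OF conn_lin[OF q]] linear_cmul[OF conn_lin[OF q]])
  then show "(a, conn q p a) = (\<Sum>i\<in>UNIV. a $ i *\<^sub>R delta_q g q p i)"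
    using vec_expand[of a] by (simp add: delta_q_conn q prod_eq_iff fst_sum snd_sum)
next
  show "(0, b) = (\<Sum>i\<in>UNIV. b $ i *\<^sub>R partial_p i)"
    using vec_expand[of b] by (simp add: partial_p_def prod_eq_iff fst_sum snd_sum)
qed

lemma metric_expand: "q \<in> S \<Longrightarrow> g q a a' = (\<Sum>i\<in>UNIV. \<Sum>j\<in>UNIV. a $ i * a' $ j * lower g q i j)"
  using bilinear_expand[OF base.bil, of q a "\<lambda>i. axis i 1" a'] vec_expand[of a] vec_expand[of a']
  by (simp add: lower_def)

text \<open>\<open>gsup\<close> is determined by duality with \<open>g\<close>.  Its derivative is computed from this characterization,
not from the entries of the inverse matrix.\<close>

lemma gsup_flat:
  assumes q: "q \<in> S"
  shows "gsup q b (flat q v) = b \<bullet> v" and "\<exists>v. b = flat q v"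
proof -
  define M where "M = (\<chi> k l. lower g q k l)"
  have M: "M *v v = flat q v" for v
  proof (rule vector_eq_rdot[THEN iffD1], rule allI)
    fix z
    have "z \<bullet> (M *v v) = (\<Sum>i\<in>UNIV. \<Sum>j\<in>UNIV. z $ i * v $ j * lower g q i j)"
      by (simp add: inner_vec_def matrix_vector_mult_def M_def sum_distrib_left mult_ac)
    then show "(M *v v) \<bullet> z = flat q v \<bullet> z"
      using metric_expand[OF q, of z v] base.sym[OF q, of v z] flat_inner[OF q, of v z]
        inner_commute[of "M *v v" z] by simp
  qed
  have "v = 0" if "M *v v = 0" for v
  proof (rule ccontr)
    assume "v \<noteq> 0"
    then have "g q v v > 0" by (rule base.pos[OF q])
    then show False using flat_inner[OF q, of v v] M[of v] that by simp
  qed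
  then have "invertible M" unfolding invertible_left_inverse matrix_left_invertible_ker by blast
  then have inv: "M ** matrix_inv M = mat 1" "matrix_inv M ** M = mat 1"
    using someI_ex[of "\<lambda>B. M ** B = mat 1 \<and> B ** M = mat 1"]
    by (auto simp: invertible_def matrix_inv_def)
  have g: "gsup q b b' = b \<bullet> (matrix_inv M *v b')" for b b'
    unfolding gsup_def upper_def M_def[symmetric]
    by (simp add: inner_vec_def matrix_vector_mult_def sum_distrib_left mult_ac)
  show "gsup q b (flat q v) = b \<bullet> v"
    unfolding g M[symmetric] by (simp add: matrix_vector_mul_assoc inv)
  have "flat q (matrix_inv M *v b) = b"
    unfolding M[symmetric] by (simp add: matrix_vector_mul_assoc inv)
  then show "\<exists>v. b = flat q v" by metis
qed

lemma gsup_sym: "q \<in> S \<Longrightarrow> gsup q b b' = gsup q b' b"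
proof -
  assume q: "q \<in> S"
  obtain v v' where "b = flat q v" "b' = flat q v'" using gsup_flat(2)[OF q] by metis
  then show ?thesis
    using base.sym[OF q] by (simp add: gsup_flat flat_inner q)
qed

lemma gsup_nonneg: "q \<in> S \<Longrightarrow> gsup q b b \<ge> 0"
proof -
  assume q: "q \<in> S"
  obtain v where "b = flat q v" using gsup_flat(2)[OF q] by metis
  then show ?thesis
    using base.pos[OF q, of v] linear_0[OF base.lin2[OF q]]
    by (cases "v = 0") (auto simp: gsup_flat flat_inner q)
qed

lemma energy_gsup: "energy g q p = gsup q p p / 2"
  by (simp add: energy_def gsup_def)

lemma energy_scale: "energy g q (s *\<^sub>R p) = s\<^sup>2 * energy g q p"
  unfolding energy_def by (simp add: sum_distrib_left power2_eq_square mult_ac)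

lemma energy_0 [simp]: "energy g q 0 = 0" by (simp add: energy_def)

lemma horizontal_form:
  assumes q: "q \<in> S"
  shows "F (q, p) (a, conn q p a) (a', conn q p a') =
     A * g q a a' - c * (lam (energy g q p))\<^sup>2 / A * (p \<bullet> a) * (p \<bullet> a')"
proof -
  have u: "(q, p) \<in> S \<times> UNIV" using q by simp
  have "F (q, p) (a, conn q p a) (a', conn q p a')
     = (\<Sum>i\<in>UNIV. \<Sum>j\<in>UNIV. a $ i * a' $ j * G_qq A c lam g q p i j)"
    unfolding frame_expand(1)[OF q] bilinear_expand[OF total.bil[OF u]] horizontal[OF q] ..
  also have "\<dots> = A * (\<Sum>i\<in>UNIV. \<Sum>j\<in>UNIV. a $ i * a' $ j * lower g q i j)
     - c * (lam (energy g q p))\<^sup>2 / A * (\<Sum>i\<in>UNIV. \<Sum>j\<in>UNIV. p $ i * a $ i * (p $ j * a' $ j))"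
    unfolding sum_distrib_left sum_subtractf[symmetric]
    by (simp add: G_qq_def Let_def algebra_simps)
  also have "(\<Sum>i\<in>UNIV. \<Sum>j\<in>UNIV. p $ i * a $ i * (p $ j * a' $ j)) = (p \<bullet> a) * (p \<bullet> a')"
    by (simp add: inner_vec_def sum_product)
  finally show ?thesis using metric_expand[OF q, of a a'] by simp
qed

lemma vertical_even: "F (q, - p) (0, b) (0, b') = F (q, p) (0, b) (0, b')" if q: "q \<in> S"
proof -
  have "energy g q (- p) = energy g q p" using energy_scale[of q "-1" p] by simp
  moreover have "g0 g q (- p) i = - g0 g q p i" for i by (simp add: g0_def sum_negf)
  ultimately have "G_pp A c lam g q (- p) i j = G_pp A c lam g q p i j" for i j
    by (simp add: G_pp_def Let_def)
  moreover have "(q, p) \<in> S \<times> UNIV" "(q, - p) \<in> S \<times> UNIV" using q by auto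
  ultimately show ?thesis
    unfolding frame_expand(2) by (simp add: bilinear_expand[OF total.bil] vertical q)
qed

abbreviation "\<alpha> \<equiv> (lam 0)\<^sup>2 / A"

lemma vertical_zero_section: "F (q, 0) (0, b) (0, b') = \<alpha> * gsup q b b'" if q: "q \<in> S"
proof -
  have "(q, 0) \<in> S \<times> UNIV" using q by auto
  then show ?thesis
    unfolding frame_expand(2)
    by (simp add: bilinear_expand[OF total.bil] vertical q G_pp_def g0_def gsup_def Let_def sum_distrib_left mult_ac)
qed

lemma mixed_form:
  assumes q: "q \<in> S"
  shows "F (q, p) (0, b) (a, conn q p a) = 0"
proof -
  have u: "(q, p) \<in> S \<times> UNIV" using q by simp
  have "F (q, p) (0, b) (a, conn q p a)
     = (\<Sum>(i, j)\<in>UNIV \<times> UNIV. F (q, p) (b $ i *\<^sub>R partial_p i) (a $ j *\<^sub>R delta_q g q p j))"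
    unfolding frame_expand(1)[OF q] frame_expand(2)[of b] by (rule bilinear_sum[OF total.bil[OF u]])
  also have "\<dots> = 0"
    by (intro sum.neutral) (auto simp: total.scale1[OF u] total.scale2[OF u] mixed q)
  finally show ?thesis .
qed

lemma conn_0 [simp]: "q \<in> S \<Longrightarrow> conn q 0 a = 0"
  using conn_scale[of q 0] by simp

text \<open>In the coordinate frame the metric is not block diagonal, since the coordinate vector \<open>(a, 0)\<close> differs
from the horizontal lift of \<open>a\<close> by the vertical vector \<open>(0, conn q p a)\<close>.\<close>

lemma mixed_coordinates:
  assumes q: "q \<in> S"
  shows "F (q, p) (0, b) (a, 0) = - F (q, p) (0, b) (0, conn q p a)"
proof -
  have "F (q, p) (0, b) (a, conn q p a) = F (q, p) (0, b) (a, 0) + F (q, p) (0, b) (0, conn q p a)"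
    using q total.add2[of "(q, p)" "(0, b)" "(a, 0)" "(0, conn q p a)"] by simp
  then show ?thesis by (simp add: mixed_form q)
qed

lemma mixed_zero_section: "q \<in> S \<Longrightarrow> F (q, 0) (0, b) (a, 0) = 0"
  using mixed_form[of q 0 b a] by simp

lemma horizontal_coordinates:
  assumes q: "q \<in> S"
  shows "F (q, p) (a, 0) (a', 0) = A * g q a a' - c * (lam (energy g q p))\<^sup>2 / A * (p \<bullet> a) * (p \<bullet> a')
     + F (q, p) (0, conn q p a) (0, conn q p a')"
proof -
  have u: "(q, p) \<in> S \<times> UNIV" using q by simp
  show ?thesis
    using mixed_form[OF q] horizontal_form[OF q, of p a a'] total.sym[OF u, of "(a, conn q p a)"]
      total.diff1[OF u, of "(a, conn q p a)" "(0, conn q p a)"]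
      total.diff2[OF u, of _ "(a', conn q p a')" "(0, conn q p a')"]
    by simp
qed

section \<open>The curvature on the zero section\<close>

text \<open>A mixed component vanishes identically along the zero section.\<close>

lemma D_mixed_horizontal:
  assumes q: "q \<in> S"
  shows "dir_deriv (\<lambda>u. F u (0, b) (a, 0)) (q, 0) (x, 0) = 0"
    "dir_deriv (\<lambda>u. F u (a, 0) (0, b)) (q, 0) (x, 0) = 0"
proof -
  have u: "(q, 0) \<in> S \<times> UNIV" using q by simp
  have "dir_deriv (\<lambda>u. F u (0, b) (a, 0)) (q, 0) (x, 0) = dir_deriv (\<lambda>x. F (x, 0) (0, b) (a, 0)) q x"
    by (rule dir_deriv_zero_section(1)[symmetric, OF total.dG[OF u]])
  also have "\<dots> = dir_deriv (\<lambda>x. 0) q x"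
    by (rule dir_deriv_cong[OF base.open_S q mixed_zero_section])
  finally show "dir_deriv (\<lambda>u. F u (0, b) (a, 0)) (q, 0) (x, 0) = 0" by (simp add: dir_deriv_const)
  then show "dir_deriv (\<lambda>u. F u (a, 0) (0, b)) (q, 0) (x, 0) = 0"
    using total.DG_sym[OF u, of "(a, 0)" "(0, b)"] by simp
qed

lemma horizontal_even: "F (q, - p) (a, 0) (a', 0) = F (q, p) (a, 0) (a', 0)" if q: "q \<in> S"
proof -
  have "energy g q (- p) = energy g q p" using energy_scale[of q "-1" p] by simp
  moreover have "conn q (- p) x = - conn q p x" for x using conn_scale[OF q, of "-1" p] by simp
  moreover have "F (q, p) (0, - b) (0, - b') = F (q, p) (0, b) (0, b')" for b b'
    using total.neg1[of "(q, p)" "(0, b)"] total.neg2[of "(q, p)" _ "(0, b')"] q by simp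
  ultimately show ?thesis by (simp add: horizontal_coordinates q vertical_even)
qed

text \<open>A horizontal component is even in the fibre coordinate.\<close>

lemma D_horizontal_vertical:
  assumes q: "q \<in> S"
  shows "dir_deriv (\<lambda>u. F u (a, 0) (a', 0)) (q, 0) (0, b) = 0"
proof (rule even_imp_derivative_zero)
  have "(\<lambda>u. F u (a, 0) (a', 0)) differentiable (at (q, 0 *\<^sub>R b))"
    using total.dG q by simp
  from has_real_derivative_along_fiber[OF this]
  show "((\<lambda>s. F (q, s *\<^sub>R b) (a, 0) (a', 0)) has_real_derivative
      dir_deriv (\<lambda>u. F u (a, 0) (a', 0)) (q, 0) (0, b)) (at 0)" by simp
  show "F (q, (- s) *\<^sub>R b) (a, 0) (a', 0) = F (q, s *\<^sub>R b) (a, 0) (a', 0)" for s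
    using horizontal_even[OF q, of "s *\<^sub>R b"] by simp
qed

text \<open>Along the fibre, a mixed component is \<open>s\<close> times a differentiable function of \<open>s\<close>, so that the
derivative at 0 only involves the metric at the zero section.\<close>

lemma D_mixed_vertical:
  assumes q: "q \<in> S"
  shows "dir_deriv (\<lambda>u. F u (0, b) (a, 0)) (q, 0) (0, b') = - \<alpha> * gsup q b (conn q b' a)"
    "dir_deriv (\<lambda>u. F u (a, 0) (0, b)) (q, 0) (0, b') = - \<alpha> * gsup q b (conn q b' a)"
proof -
  have u: "(q, 0) \<in> S \<times> UNIV" using q by simp
  let ?h = "\<lambda>s. F (q, s *\<^sub>R b') (0, b) (0, conn q b' a)"
  have "(\<lambda>u. F u (0, b) (a, 0)) differentiable (at (q, 0 *\<^sub>R b'))"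
    "(\<lambda>u. F u (0, b) (0, conn q b' a)) differentiable (at (q, 0 *\<^sub>R b'))"
    using total.dG q by simp_all
  note d = this[THEN has_real_derivative_along_fiber]
  have "F (q, s *\<^sub>R b') (0, b) (a, 0) = - (s * ?h s)" for s
    using total.scale2[of "(q, s *\<^sub>R b')" "(0, b)" s "(0, conn q b' a)"] q
    by (simp add: mixed_coordinates conn_scale)
  then have "((\<lambda>s. - (s * ?h s)) has_real_derivative
      dir_deriv (\<lambda>u. F u (0, b) (a, 0)) (q, 0) (0, b')) (at 0)" using d(1) by simp
  moreover have "((\<lambda>s. - (s * ?h s)) has_real_derivative - ?h 0) (at 0)"
    by (rule derivative_eq_intros d(2) refl)+ simp
  ultimately have "dir_deriv (\<lambda>u. F u (0, b) (a, 0)) (q, 0) (0, b') = - ?h 0"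
    by (rule DERIV_unique)
  then show "dir_deriv (\<lambda>u. F u (0, b) (a, 0)) (q, 0) (0, b') = - \<alpha> * gsup q b (conn q b' a)"
    by (simp add: vertical_zero_section q)
  then show "dir_deriv (\<lambda>u. F u (a, 0) (0, b)) (q, 0) (0, b') = - \<alpha> * gsup q b (conn q b' a)"
    using total.DG_sym[OF u, of "(a, 0)" "(0, b)"] by simp
qed

text \<open>The dual metric is parallel: differentiate the pairing \<open>gsup x b (flat x v) = b \<bullet> v\<close>, which does not
depend on \<open>x\<close>.\<close>

lemma D_vertical_horizontal:
  assumes q: "q \<in> S"
  shows "dir_deriv (\<lambda>u. F u (0, b) (0, b')) (q, 0) (a, 0)
    = - \<alpha> * (gsup q (conn q b a) b' + gsup q b (conn q b' a))"
proof -
  let ?P = "\<lambda>x b b'. F (x, 0) (0, b) (0, b')"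
  have u: "(x, 0) \<in> S \<times> UNIV" if "x \<in> S" for x using that by simp
  obtain v where v: "b' = flat q v" using gsup_flat(2)[OF q] by metis
  have df: "((\<lambda>x. flat x v) has_derivative (\<lambda>y. \<Sum>e\<in>Basis. dir_deriv (\<lambda>x. g x v e) q y *\<^sub>R e)) (at q)"
    unfolding flat_def covector_def
    by (intro derivative_intros has_derivative_dir_deriv base.dG q)
  have Df: "dir_deriv (\<lambda>x. flat x v) q a = flat q (base.\<Gamma> q a v) + conn q b' a"
  proof (rule euclidean_eqI)
    fix e :: "real ^ 'n" assume e: "e \<in> Basis"
    have "dir_deriv (\<lambda>x. flat x v) q a \<bullet> e = dir_deriv (\<lambda>x. g x v e) q a"
      using e unfolding dir_deriv_eqI[OF df] by simp
    then show "dir_deriv (\<lambda>x. flat x v) q a \<bullet> e = (flat q (base.\<Gamma> q a v) + conn q b' a) \<bullet> e"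
      by (simp add: base.metric_compatible q inner_add_left flat_inner conn_inner v)
  qed
  have dP: "(\<lambda>x. ?P x b w) differentiable (at q)" for w
    by (rule dir_deriv_zero_section(2)[OF total.dG[OF u[OF q]]])
  have linP: "linear (?P x b)" if "x \<in> S" for x
    using total.add2[OF u[OF that], of "(0, b)" "(0, _)" "(0, _)"]
      total.scale2[OF u[OF that], of "(0, b)" _ "(0, _)"]
    by (intro linearI) simp_all
  have "dir_deriv (\<lambda>x. ?P x b (flat x v)) q a = dir_deriv (\<lambda>x. \<alpha> * (b \<bullet> v)) q a"
    by (rule dir_deriv_cong[OF base.open_S q]) (simp add: vertical_zero_section gsup_flat)
  then have "dir_deriv (\<lambda>x. ?P x b (flat x v)) q a = 0" by (simp add: dir_deriv_const)
  moreover have "dir_deriv (\<lambda>x. ?P x b (flat x v)) q a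
      = dir_deriv (\<lambda>x. ?P x b (flat q v)) q a + ?P q b (dir_deriv (\<lambda>x. flat x v) q a)"
    by (rule dir_deriv_linear_family[OF base.open_S q, where F = "\<lambda>x. ?P x b"])
      (use linP dP df in \<open>auto simp: differentiable_def\<close>)
  ultimately have "dir_deriv (\<lambda>x. ?P x b b') q a
      = - ?P q b (flat q (base.\<Gamma> q a v)) - ?P q b (conn q b' a)"
    by (simp add: v[symmetric] Df linear_add[OF linP[OF q]])
  moreover have "gsup q (conn q b a) b' = b \<bullet> base.\<Gamma> q a v"
    by (simp add: v gsup_flat conn_inner q)
  ultimately show ?thesis
    using dir_deriv_zero_section(1)[OF total.dG[OF u[OF q]], of "(0, b)" "(0, b')" a]
    by (simp add: vertical_zero_section gsup_flat q algebra_simps)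
qed

text \<open>By the first equation the fibre through \<open>q\<close> has vanishing second fundamental form at \<open>(q, 0)\<close>, by the
second one the zero section is totally geodesic.\<close>

lemma koszul_zero_section:
  assumes q: "q \<in> S"
  shows "koszul F (q, 0) (0, b) (0, b) (a, 0) = 0"
    "koszul F (q, 0) (a, 0) (a, 0) (0, b) = 0"
    "koszul F (q, 0) (a, 0) (0, b) (a', 0) = 0"
    "koszul F (q, 0) (a, 0) (0, b) (0, b') = - \<alpha> * gsup q (conn q b a) b'"
  using gsup_sym[OF q]
  by (simp_all add: koszul_def D_mixed_horizontal D_horizontal_vertical D_mixed_vertical
      D_vertical_horizontal q algebra_simps)

lemma vertical_eq_0: "q \<in> S \<Longrightarrow> F (q, 0) (0, b) (0, b) = 0 \<Longrightarrow> b = 0"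
  using total.pos[of "(q, 0)" "(0, b)"] by (cases "b = 0") (auto simp: zero_prod_def)

lemma total_split:
  assumes q: "q \<in> S"
  shows "F (q, 0) (x, y) (x', y') = F (q, 0) (x, 0) (x', 0) + F (q, 0) (0, y) (0, y')"
proof -
  have u: "(q, 0) \<in> S \<times> UNIV" using q by simp
  show ?thesis
    using mixed_zero_section[OF q] total.sym[OF u, of "(x, 0)" "(0, y')"]
      total.add1[OF u, of "(x, 0)" "(0, y)"] total.add2[OF u, of _ "(x', 0)" "(0, y')"]
    by simp
qed

text \<open>The coordinate frame is not parallel along the zero section: vertical vectors are moved by the
connection of the base.\<close>

lemma levi_civita_mixed_zero_section:
  assumes q: "q \<in> S"
  shows "total.\<Gamma> (q, 0) (a, 0) (0, b) = (0, - conn q b a)"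
proof -
  have u: "(q, 0) \<in> S \<times> UNIV" using q by simp
  show ?thesis
  proof (rule total.nondegenerate[OF u])
    fix z :: "(real ^ 'n) \<times> (real ^ 'n)"
    obtain x y where z: "z = (x, y)" by (cases z)
    have "(x, y) = (x, 0) + (0, y)" by simp
    then have "F (q, 0) (total.\<Gamma> (q, 0) (a, 0) (0, b)) z = - \<alpha> * gsup q (conn q b a) y"
      by (simp only: z total.levi_civita_koszul[OF u] total.koszul_lin(3)[OF u, THEN linear_add]
          koszul_zero_section[OF q] add_0)
    also have "\<dots> = F (q, 0) (0, - conn q b a) (0, y)"
      using total.neg1[OF u, of "(0, conn q b a)" "(0, y)"] by (simp add: vertical_zero_section q)
    also have "\<dots> = F (q, 0) (0, - conn q b a) z"
      using total.add2[OF u, of "(0, - conn q b a)" "(x, 0)" "(0, y)"]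
      by (simp add: z mixed_zero_section q)
    finally show "F (q, 0) (total.\<Gamma> (q, 0) (a, 0) (0, b)) z = F (q, 0) (0, - conn q b a) z" .
  qed
qed

lemma levi_civita_orthogonal:
  assumes q: "q \<in> S"
  shows "F (q, 0) (total.\<Gamma> (q, 0) (a, 0) (a, 0)) (total.\<Gamma> (q, 0) (0, b) (0, b)) = 0"
proof -
  have u: "(q, 0) \<in> S \<times> UNIV" using q by simp
  obtain v w where vw: "total.\<Gamma> (q, 0) (a, 0) (a, 0) = (v, w)" by (metis surj_pair)
  have "F (q, 0) (v, w) (0, w) = 0"
    using total.levi_civita_koszul[OF u, of "(a, 0)" "(a, 0)" "(0, w)"]
    by (simp add: vw koszul_zero_section q)
  then have "w = 0"
    using total_split[OF q, of v w 0 w] linear_0[OF total.lin2[OF u]] vertical_eq_0[OF q]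
    by (simp add: zero_prod_def[symmetric])
  then show ?thesis
    using total.levi_civita_koszul[OF u, of "(0, b)" "(0, b)" "(v, 0)"] total.sym[OF u]
    by (simp add: vw koszul_zero_section q)
qed

text \<open>On the fibre through \<open>q\<close> the function \<open>F (q, s b) (a, 0) (a, 0)\<close> equals \<open>A * g q a a + s\<^sup>2 * \<psi> s\<close>, where \<open>\<psi>\<close>
collects the quadratic term of the horizontal block and the square of \<open>conn q b a\<close>.\<close>

lemma DD_horizontal:
  assumes q: "q \<in> S"
  shows "dir_deriv (\<lambda>u. dir_deriv (\<lambda>u. F u (a, 0) (a, 0)) u (0, b)) (q, 0) (0, b)
    = 2 * (\<alpha> * gsup q (conn q b a) (conn q b a) - c * (lam 0)\<^sup>2 / A * (b \<bullet> a)\<^sup>2)"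
proof -
  have u: "(q, p) \<in> S \<times> UNIV" for p using q by simp
  let ?c = "conn q b a"
  define \<psi> where "\<psi> s = F (q, s *\<^sub>R b) (0, ?c) (0, ?c)
      - c * (lam (s\<^sup>2 * energy g q b))\<^sup>2 / A * (b \<bullet> a)\<^sup>2" for s
  have "dir_deriv (\<lambda>u. dir_deriv (\<lambda>u. F u (a, 0) (a, 0)) u (0, b)) (q, 0) (0, b) = 2 * \<psi> 0"
  proof (rule lhopital_second_order)
    show "((\<lambda>s. F (q, s *\<^sub>R b) (a, 0) (a, 0)) has_real_derivative
        dir_deriv (\<lambda>u. F u (a, 0) (a, 0)) (q, s *\<^sub>R b) (0, b)) (at s)" for s
      by (rule has_real_derivative_along_fiber[OF total.dG[OF u]])
    have "(\<lambda>u. dir_deriv (\<lambda>u. F u (a, 0) (a, 0)) u (0, b)) differentiable (at (q, 0 *\<^sub>R b))"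
      using total.ddG u by simp
    from has_real_derivative_along_fiber[OF this]
    show "((\<lambda>s. dir_deriv (\<lambda>u. F u (a, 0) (a, 0)) (q, s *\<^sub>R b) (0, b)) has_real_derivative
       dir_deriv (\<lambda>u. dir_deriv (\<lambda>u. F u (a, 0) (a, 0)) u (0, b)) (q, 0) (0, b)) (at 0)"
      by simp
    show "dir_deriv (\<lambda>u. F u (a, 0) (a, 0)) (q, 0 *\<^sub>R b) (0, b) = 0"
      by (simp add: D_horizontal_vertical q)
    show "F (q, s *\<^sub>R b) (a, 0) (a, 0) = A * g q a a + s\<^sup>2 * \<psi> s" for s
      using total.scale1[OF u, of "s *\<^sub>R b" s "(0, ?c)"] total.scale2[OF u, of "s *\<^sub>R b" _ s "(0, ?c)"]
      by (simp add: horizontal_coordinates q conn_scale energy_scale \<psi>_def power2_eq_square algebra_simps)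
    have "((\<lambda>s. F (q, s *\<^sub>R b) (0, ?c) (0, ?c)) \<longlongrightarrow> F (q, 0 *\<^sub>R b) (0, ?c) (0, ?c)) (at 0)"
      using DERIV_isCont[OF has_real_derivative_along_fiber[OF total.dG[OF u]]]
      unfolding isCont_def by blast
    note t1 = tendsto_within_subset[OF this subset_UNIV, of "{0<..}"]
    have e: "energy g q b \<ge> 0" using gsup_nonneg[OF q] by (simp add: energy_gsup)
    have "continuous_on UNIV (\<lambda>s. lam (s\<^sup>2 * energy g q b))"
      by (rule continuous_on_compose2[OF lam_cont]) (auto intro!: continuous_intros mult_nonneg_nonneg e)
    then have "((\<lambda>s. lam (s\<^sup>2 * energy g q b)) \<longlongrightarrow> lam (0\<^sup>2 * energy g q b)) (at 0)"
      by (metis UNIV_I continuous_on_def)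
    note t2 = tendsto_within_subset[OF this subset_UNIV, of "{0<..}"]
    show "(\<psi> \<longlongrightarrow> \<psi> 0) (at_right 0)"
      unfolding \<psi>_def by (intro tendsto_intros t1 t2) (use A_pos in auto)
  qed
  then show ?thesis by (simp add: \<psi>_def vertical_zero_section q)
qed

text \<open>In \<open>curvature_koszul\<close> for \<open>X = (a, 0)\<close> and \<open>Y = (0, b)\<close> the first term vanishes because its Koszul
expression is zero along the whole zero section, and the third one by orthogonality.  The second term
contributes half of \<open>DD_horizontal\<close> with a minus sign, and its part in \<open>conn q b a\<close> cancels against
the last term, the square of \<open>levi_civita_mixed_zero_section\<close>.\<close>

lemma R_zero_section:
  assumes q: "q \<in> S"
  shows "total.R (q, 0) (a, 0) (0, b) (0, b) (a, 0) = c * (lam 0)\<^sup>2 / A * (b \<bullet> a)\<^sup>2"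
proof -
  have u: "(q, 0) \<in> S \<times> UNIV" using q by simp
  let ?X = "(a, 0) :: (real ^ 'n) \<times> (real ^ 'n)" and ?Y = "(0, b) :: (real ^ 'n) \<times> (real ^ 'n)"
  have "dir_deriv (\<lambda>u. koszul F u ?Y ?Y ?X) (q, 0) ?X = dir_deriv (\<lambda>x. koszul F (x, 0) ?Y ?Y ?X) q a"
    by (rule dir_deriv_zero_section(1)[symmetric, OF total.koszul_differentiable[OF u]])
  also have "\<dots> = dir_deriv (\<lambda>x. 0) q a"
    by (rule dir_deriv_cong[OF base.open_S q koszul_zero_section(1)])
  finally have 1: "dir_deriv (\<lambda>u. koszul F u ?Y ?Y ?X) (q, 0) ?X = 0" by (simp add: dir_deriv_const)
  have "dir_deriv (\<lambda>u. koszul F u ?X ?Y ?X) (q, 0) ?Y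
      = dir_deriv (\<lambda>u. (1/2) * dir_deriv (\<lambda>u. F u ?X ?X) u ?Y) (q, 0) ?Y"
    by (rule dir_deriv_cong[OF total.open_S u])
      (simp add: koszul_def total.DG_sym[of _ ?Y ?X ?X])
  then have 2: "dir_deriv (\<lambda>u. koszul F u ?X ?Y ?X) (q, 0) ?Y
      = \<alpha> * gsup q (conn q b a) (conn q b a) - c * (lam 0)\<^sup>2 / A * (b \<bullet> a)\<^sup>2"
    by (simp only: dir_deriv_cmult[OF total.ddG[OF u]] DD_horizontal[OF q]) (simp add: field_simps)
  have "F (q, 0) (0, - conn q b a) (0, - conn q b a) = \<alpha> * gsup q (conn q b a) (conn q b a)"
    using total.neg1[OF u, of "(0, conn q b a)"] total.neg2[OF u, of _ "(0, conn q b a)"]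
    by (simp add: vertical_zero_section q)
  then show ?thesis
    unfolding total.R_def total.curvature_koszul[OF u] 1 2 levi_civita_orthogonal[OF q]
      total.levi_civita_sym[OF u, of ?Y ?X] levi_civita_mixed_zero_section[OF q]
    by simp
qed

end

section \<open>The complex structure on the zero section\<close>

locale cotangent_kaehler = cotangent_metric S g F A c lam + kaehler: kaehler_chart "S \<times> UNIV" F J
  for S :: "(real ^ 'n) set" and g :: "'n local_metric"
    and F :: "(real ^ 'n) \<times> (real ^ 'n) \<Rightarrow> (real ^ 'n) \<times> (real ^ 'n) \<Rightarrow> (real ^ 'n) \<times> (real ^ 'n) \<Rightarrow> real"
    and A c :: real and lam :: "real \<Rightarrow> real"
    and J :: "(real ^ 'n) \<times> (real ^ 'n) \<Rightarrow> (real ^ 'n) \<times> (real ^ 'n) \<Rightarrow> (real ^ 'n) \<times> (real ^ 'n)" +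
  assumes J_horizontal: "\<And>q p i. q \<in> S \<Longrightarrow>
     J (q, p) (delta_q g q p i) = (\<Sum>j\<in>UNIV. J1 A c lam g q p i j *\<^sub>R partial_p j)"
begin

text \<open>At \<open>p = 0\<close> the rank-one part of \<open>J1\<close> disappears and the horizontal lift of \<open>a\<close> is \<open>(a, 0)\<close> itself.\<close>

lemma J_zero_section:
  assumes q: "q \<in> S"
  shows "J (q, 0) (a, 0) = (0, (A / lam 0) *\<^sub>R flat q a)"
proof -
  have u: "(q, 0) \<in> S \<times> UNIV" using q by simp
  define r where "r = A / lam 0"
  have flat: "(\<Sum>i\<in>UNIV. a $ i * lower g q i h) = flat q a $ h" for h
  proof -
    have "flat q a $ h = g q a (axis h 1)"
      using cart_eq_inner_axis[of "flat q a" h] flat_inner[OF q, of a "axis h 1"] by simp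
    also have "\<dots> = (\<Sum>i\<in>UNIV. a $ i * lower g q i h)"
      unfolding metric_expand[OF q] by (simp add: axis_def if_distrib if_distribR cong: if_cong)
    finally show ?thesis by simp
  qed
  have comp: "(\<Sum>i\<in>UNIV. a $ i * (r * lower g q i h)) = r * flat q a $ h" for h
    unfolding flat[symmetric] sum_distrib_left by (simp add: mult_ac)
  have J: "J (q, 0) (delta_q g q 0 i) = (0, \<chi> h. r * lower g q i h)" for i
    using frame_expand(2)[of "\<chi> h. r * lower g q i h"] J_horizontal[OF q, of 0 i]
    by (simp add: J1_def r_def)
  have "(a, 0) = (\<Sum>i\<in>UNIV. a $ i *\<^sub>R delta_q g q 0 i)"
    using frame_expand(1)[OF q, of a 0] q by simp
  then have "J (q, 0) (a, 0) = (\<Sum>i\<in>UNIV. a $ i *\<^sub>R (0, \<chi> h. r * lower g q i h))"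
    by (simp add: linear_sum[OF kaehler.J_lin[OF u]] linear_cmul[OF kaehler.J_lin[OF u]] J)
  also have "\<dots> = (0, r *\<^sub>R flat q a)"
    by (simp add: prod_eq_iff fst_sum snd_sum vec_eq_iff comp)
  finally show ?thesis by (simp add: r_def)
qed

lemma R_J_zero_section:
  assumes q: "q \<in> S"
  shows "total.R (q, 0) (a, 0) (J (q, 0) (a', 0)) (J (q, 0) (a', 0)) (a, 0) = c * A * (g q a' a)\<^sup>2"
proof -
  have "lam 0 > 0" by (rule lam_pos) simp
  then show ?thesis
    using A_pos by (simp add: J_zero_section R_zero_section q flat_inner field_simps power2_eq_square)
qed

text \<open>For orthogonal \<open>x\<close> and \<open>y\<close> the mixed curvature \<open>R (x, 0) (J (y, 0)) (J (y, 0)) (x, 0)\<close> vanishes, whereas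
constancy would make it proportional to \<open>k\<close>; the value of \<open>k\<close> on \<open>(x, 0)\<close> then determines \<open>c\<close>.\<close>

lemma constant_holomorphic_imp_zero:
  assumes q: "q \<in> S" and n: "CARD('n) \<ge> 2"
    and H: "\<And>X. X \<noteq> 0 \<Longrightarrow> sectional_curvature F (q, 0) X (J (q, 0) X) = k"
  shows "k = 0" "c = 0"
proof -
  have u: "(q, 0) \<in> S \<times> UNIV" using q by simp
  have GX: "F (q, 0) (a, 0) (a', 0) = A * g q a a'" for a a'
    using horizontal_form[OF q, of 0 a a'] q by simp
  obtain i j :: 'n where ij: "i \<noteq> j"
  proof -
    have "\<not> CARD('n) \<le> Suc 0" using n by simp
    then have "\<exists>i j :: 'n. i \<noteq> j" by (subst (asm) card_le_Suc0_iff_eq) auto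
    then show ?thesis using that by blast
  qed
  define x :: "real ^ 'n" where "x = axis i 1"
  \<comment> \<open>One Gram-Schmidt step for the metric \<open>g q\<close>.\<close>
  define y where "y = axis j 1 - (g q x (axis j 1) / g q x x) *\<^sub>R x"
  have "x $ i = 1" "y $ j = 1" using ij by (simp_all add: x_def y_def axis_def)
  then have "x \<noteq> 0" "y \<noteq> 0" by auto
  then have p: "g q x x > 0" "g q y y > 0" by (simp_all add: base.pos q)
  then have xy: "g q x y = 0" by (simp add: y_def base.diff2 base.scale2 q)
  have "4 * total.R (q, 0) (x, 0) (J (q, 0) (y, 0)) (J (q, 0) (y, 0)) (x, 0)
      = k * F (q, 0) (x, 0) (x, 0) * F (q, 0) (y, 0) (y, 0)"
    by (rule kaehler.constant_holomorphic_imp_mixed[OF u H])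
      (use total.sym[OF u, of "(x, 0)"] in \<open>auto simp: GX xy J_zero_section mixed_zero_section q\<close>)
  then have "k * (A * g q x x) * (A * g q y y) = 0"
    by (simp add: R_J_zero_section q GX xy base.sym[OF q, of y x])
  then show "k = 0" using p A_pos by simp
  then have "c * A * (g q x x)\<^sup>2 = 0"
    using kaehler.holomorphic_R[OF u H, of "(x, 0)"] by (simp add: R_J_zero_section q)
  then show "c = 0" using p A_pos by simp
qed

end

section \<open>Charts of the cotangent bundle\<close>

context
  fixes M :: "'a topology" and atl :: "('a, 'e::euclidean_space) chart set"
  assumes M: "smooth_manifold M atl"
begin

lemma chart_inj: "\<kappa> \<in> atl \<Longrightarrow> inj_on (snd \<kappa>) (fst \<kappa>)"
  and chart_image_open: "\<kappa> \<in> atl \<Longrightarrow> openin M U \<Longrightarrow> U \<subseteq> fst \<kappa> \<Longrightarrow> open (snd \<kappa> ` U)"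
  and chart_domain_open: "\<kappa> \<in> atl \<Longrightarrow> openin M (fst \<kappa>)"
proof -
  assume \<kappa>: "\<kappa> \<in> atl"
  then have o: "openin M (fst \<kappa>)" "open (coord_image \<kappa>)"
    and h: "homeomorphic_map (subtopology M (fst \<kappa>)) (top_of_set (coord_image \<kappa>)) (snd \<kappa>)"
    using M by (auto simp: smooth_manifold_def)
  show "openin M (fst \<kappa>)" by fact
  show "inj_on (snd \<kappa>) (fst \<kappa>)"
    using homeomorphic_imp_injective_map[OF h] openin_subset[OF o(1)]
    by (simp add: Int_absorb1)
  assume "openin M U" "U \<subseteq> fst \<kappa>"
  then have "openin (subtopology M (fst \<kappa>)) U" by (metis openin_subtopology inf.absorb_iff1)
  then have "openin (top_of_set (coord_image \<kappa>)) (snd \<kappa> ` U)"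
    using homeomorphic_imp_open_map[OF h] by (simp add: open_map_def)
  then show "open (snd \<kappa> ` U)" using o(2) openin_open_trans by blast
qed

lemma transition_apply: "\<kappa> \<in> atl \<Longrightarrow> x \<in> fst \<kappa> \<Longrightarrow> transition \<kappa> \<kappa>' (snd \<kappa> x) = snd \<kappa>' x"
  using chart_inj by (simp add: transition_def)

lemma transition_differentiable:
  assumes "\<kappa> \<in> atl" "\<kappa>' \<in> atl" "x \<in> fst \<kappa>" "x \<in> fst \<kappa>'"
  shows "transition \<kappa> \<kappa>' differentiable (at (snd \<kappa> x))"
proof -
  have "open (snd \<kappa> ` (fst \<kappa> \<inter> fst \<kappa>'))"
    using assms by (intro chart_image_open openin_Int chart_domain_open) auto
  moreover have "smooth_on (snd \<kappa> ` (fst \<kappa> \<inter> fst \<kappa>')) (transition \<kappa> \<kappa>')"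
    using M assms by (simp add: smooth_manifold_def)
  ultimately have "C2_on (snd \<kappa> ` (fst \<kappa> \<inter> fst \<kappa>')) (transition \<kappa> \<kappa>')"
    by (rule smooth_on_imp_C2_on)
  then show ?thesis using assms(3,4) by (auto simp: C2_on_def)
qed

lemma transition_deriv_dir_deriv: "transition_deriv \<kappa> \<kappa>' x v = dir_deriv (transition \<kappa> \<kappa>') (snd \<kappa> x) v"
  by (simp add: transition_deriv_def dir_deriv_def)

lemma transition_deriv_cocycle:
  assumes \<kappa>: "\<kappa>1 \<in> atl" "\<kappa>2 \<in> atl" "\<kappa>3 \<in> atl" and x: "x \<in> fst \<kappa>1" "x \<in> fst \<kappa>2" "x \<in> fst \<kappa>3"
  shows "transition_deriv \<kappa>2 \<kappa>3 x (transition_deriv \<kappa>1 \<kappa>2 x v) = transition_deriv \<kappa>1 \<kappa>3 x v"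
proof -
  let ?U = "fst \<kappa>1 \<inter> fst \<kappa>2 \<inter> fst \<kappa>3"
  have d2: "(transition \<kappa>2 \<kappa>3 has_derivative transition_deriv \<kappa>2 \<kappa>3 x) (at (transition \<kappa>1 \<kappa>2 (snd \<kappa>1 x)))"
    using has_derivative_dir_deriv[OF transition_differentiable[OF \<kappa>(2,3) x(2,3)]]
    by (simp add: transition_apply \<kappa> x transition_deriv_def dir_deriv_def[abs_def])
  have d1: "(transition \<kappa>1 \<kappa>2 has_derivative transition_deriv \<kappa>1 \<kappa>2 x) (at (snd \<kappa>1 x))"
    using has_derivative_dir_deriv[OF transition_differentiable[OF \<kappa>(1,2) x(1,2)]]
    by (simp add: transition_deriv_def dir_deriv_def[abs_def])
  have "dir_deriv (transition \<kappa>1 \<kappa>3) (snd \<kappa>1 x) v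
      = dir_deriv (\<lambda>y. transition \<kappa>2 \<kappa>3 (transition \<kappa>1 \<kappa>2 y)) (snd \<kappa>1 x) v"
  proof (rule dir_deriv_cong)
    show "open (snd \<kappa>1 ` ?U)"
      using \<kappa> by (intro chart_image_open openin_Int chart_domain_open) auto
    show "snd \<kappa>1 x \<in> snd \<kappa>1 ` ?U" using x by blast
    show "transition \<kappa>1 \<kappa>3 y = transition \<kappa>2 \<kappa>3 (transition \<kappa>1 \<kappa>2 y)" if "y \<in> snd \<kappa>1 ` ?U" for y
      using that by (auto simp: transition_apply \<kappa>)
  qed
  also have "\<dots> = transition_deriv \<kappa>2 \<kappa>3 x (transition_deriv \<kappa>1 \<kappa>2 x v)"
    by (rule dir_deriv_eqI[OF has_derivative_compose[OF d1 d2]])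
  finally show ?thesis by (simp add: transition_deriv_dir_deriv)
qed

lemma transition_deriv_self:
  assumes \<kappa>: "\<kappa> \<in> atl" and x: "x \<in> fst \<kappa>"
  shows "transition_deriv \<kappa> \<kappa> x v = v"
proof -
  have "dir_deriv (transition \<kappa> \<kappa>) (snd \<kappa> x) v = dir_deriv (\<lambda>y. y) (snd \<kappa> x) v"
  proof (rule dir_deriv_cong)
    show "open (snd \<kappa> ` fst \<kappa>)" using \<kappa> by (intro chart_image_open chart_domain_open) auto
  qed (use x in \<open>auto simp: transition_apply \<kappa>\<close>)
  then show ?thesis by (simp add: transition_deriv_dir_deriv dir_deriv_eqI[OF has_derivative_ident])
qed

text \<open>The components of the covector in the other charts are forced by the transformation law; the chain
rule for transition maps makes them consistent.\<close>

lemma covector_with_components: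
  assumes \<kappa>: "\<kappa> \<in> atl" and x: "x \<in> fst \<kappa>"
  obtains \<xi> where "\<xi> \<in> cotangent_space atl x" "\<xi> \<kappa> = p"
proof -
  define \<xi> where "\<xi> \<kappa>' = (if \<kappa>' \<in> atl \<and> x \<in> fst \<kappa>'
    then covector (\<lambda>v. p \<bullet> transition_deriv \<kappa>' \<kappa> x v) else 0)" for \<kappa>'
  have \<xi>: "\<xi> \<kappa>' \<bullet> v = p \<bullet> transition_deriv \<kappa>' \<kappa> x v" if "\<kappa>' \<in> atl" "x \<in> fst \<kappa>'" for \<kappa>' v
  proof -
    have "linear (transition_deriv \<kappa>' \<kappa> x)"
      using linear_dir_deriv[OF transition_differentiable[OF that(1) \<kappa> that(2) x]]
      by (simp add: transition_deriv_dir_deriv linear_iff)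
    then have "linear (\<lambda>v. p \<bullet> transition_deriv \<kappa>' \<kappa> x v)"
      by (simp add: linear_iff inner_add_right)
    then show ?thesis using that by (simp add: \<xi>_def covector_inner)
  qed
  have "\<xi> \<in> cotangent_space atl x"
    unfolding cotangent_space_def
  proof (intro CollectI conjI ballI impI allI)
    fix \<kappa>1 \<kappa>2 v assume *: "\<kappa>1 \<in> atl" "\<kappa>2 \<in> atl" "x \<in> fst \<kappa>1 \<inter> fst \<kappa>2"
    then show "\<xi> \<kappa>1 \<bullet> v = \<xi> \<kappa>2 \<bullet> transition_deriv \<kappa>1 \<kappa>2 x v"
      by (simp add: \<xi> transition_deriv_cocycle \<kappa> x)
  qed (auto simp: \<xi>_def)
  moreover have "\<xi> \<kappa> = p"
    by (rule vector_eq_rdot[THEN iffD1]) (simp add: \<xi> \<kappa> x transition_deriv_self)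
  ultimately show ?thesis using that by blast
qed

text \<open>An induced chart covers every covector over the base chart, so that the local computation may differentiate
freely in the fibre direction.\<close>

lemma coord_image_cotangent_chart:
  assumes \<kappa>: "\<kappa> \<in> atl"
  shows "coord_image (cotangent_chart atl \<kappa>) = coord_image \<kappa> \<times> UNIV"
proof
  show "coord_image (cotangent_chart atl \<kappa>) \<subseteq> coord_image \<kappa> \<times> UNIV"
    by (auto simp: coord_image_def cotangent_chart_def)
  show "coord_image \<kappa> \<times> UNIV \<subseteq> coord_image (cotangent_chart atl \<kappa>)"
  proof
    fix z assume "z \<in> coord_image \<kappa> \<times> (UNIV :: 'e set)"
    then obtain x p where x: "x \<in> fst \<kappa>" and z: "z = (snd \<kappa> x, p)"
      by (auto simp: coord_image_def)
    obtain \<xi> where "\<xi> \<in> cotangent_space atl x" "\<xi> \<kappa> = p"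
      using covector_with_components[OF \<kappa> x] .
    then have "(x, \<xi>) \<in> fst (cotangent_chart atl \<kappa>)" "z = snd (cotangent_chart atl \<kappa>) (x, \<xi>)"
      using x z by (auto simp: cotangent_chart_def)
    then show "z \<in> coord_image (cotangent_chart atl \<kappa>)" unfolding coord_image_def by blast
  qed
qed

end

lemma riemannian_metric_imp_chart:
  assumes "riemannian_metric atl g" "\<kappa> \<in> atl" "open (coord_image \<kappa>)"
  shows "riemannian_chart (coord_image \<kappa>) (g \<kappa>)"
proof
  show "C2_on (coord_image \<kappa>) (\<lambda>u. g \<kappa> u v w)" for v w
    using assms(1,2) by (intro smooth_on_imp_C2_on assms(3)) (simp add: riemannian_metric_def)
qed (use assms in \<open>auto simp: riemannian_metric_def\<close>)

lemma kaehler_structure_imp_chart: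
  assumes K: "kaehler_structure atl G J" and \<kappa>: "\<kappa> \<in> atl" and o: "open (coord_image \<kappa>)"
  shows "kaehler_chart (coord_image \<kappa>) (G \<kappa>) (J \<kappa>)"
proof -
  interpret riemannian_chart "coord_image \<kappa>" "G \<kappa>"
    using K \<kappa> o by (intro riemannian_metric_imp_chart) (auto simp: kaehler_structure_def)
  show ?thesis
  proof (rule kaehler_chart.intro[OF riemannian_chart_axioms], rule kaehler_chart_axioms.intro)
    show "C2_on (coord_image \<kappa>) (\<lambda>u. J \<kappa> u v)" for v
      using K \<kappa> by (intro smooth_on_imp_C2_on o)
        (simp add: kaehler_structure_def almost_complex_structure_def)
  qed (use K \<kappa> in \<open>auto simp: kaehler_structure_def almost_complex_structure_def\<close>)
qed

section \<open>Nonexistence of constant holomorphic sectional curvature\<close>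

theorem mainTheorem5:
  fixes M :: "'a topology"
    and atl :: "('a, real ^ 'n) chart set"
    and g :: "('a, real ^ 'n) metric_field"
    and A c :: real
    and lam :: "real \<Rightarrow> real"
    and G :: "('a \<times> ('a, real ^ 'n) covector, (real ^ 'n) \<times> (real ^ 'n)) metric_field"
    and J :: "('a \<times> ('a, real ^ 'n) covector, (real ^ 'n) \<times> (real ^ 'n)) endo_field"
  assumes "smooth_manifold M atl" and "topspace M \<noteq> {}"
    and "CARD('n) \<ge> 2"
    and "riemannian_metric atl g" and "constant_sectional_curvature atl g c"
    and "smooth_on {0..} lam"
    and "A > 0"
    and "\<And>t. t \<ge> 0 \<Longrightarrow> lam t > 0"
    and "\<And>t. t \<ge> 0 \<Longrightarrow> A\<^sup>2 - 2 * c * t * (lam t)\<^sup>2 > 0"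
    and "\<And>t. t \<ge> 0 \<Longrightarrow> lam t + 2 * t * half_line_deriv lam t > 0"
    and "kaehler_structure (cotangent_atlas atl) G J"
    and "\<And>\<kappa> q p i. \<kappa> \<in> atl \<Longrightarrow> q \<in> coord_image \<kappa> \<Longrightarrow>
           J (cotangent_chart atl \<kappa>) (q, p) (delta_q (g \<kappa>) q p i) =
           (\<Sum>j\<in>UNIV. J1 A c lam (g \<kappa>) q p i j *\<^sub>R partial_p j)"
    and "\<And>\<kappa> q p i. \<kappa> \<in> atl \<Longrightarrow> q \<in> coord_image \<kappa> \<Longrightarrow>
           J (cotangent_chart atl \<kappa>) (q, p) (partial_p i) =
           - (\<Sum>j\<in>UNIV. J2 A c lam (g \<kappa>) q p i j *\<^sub>R delta_q (g \<kappa>) q p j)"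
    and "\<And>\<kappa> q p i j. \<kappa> \<in> atl \<Longrightarrow> q \<in> coord_image \<kappa> \<Longrightarrow>
           G (cotangent_chart atl \<kappa>) (q, p) (delta_q (g \<kappa>) q p i) (delta_q (g \<kappa>) q p j) =
           G_qq A c lam (g \<kappa>) q p i j"
    and "\<And>\<kappa> q p i j. \<kappa> \<in> atl \<Longrightarrow> q \<in> coord_image \<kappa> \<Longrightarrow>
           G (cotangent_chart atl \<kappa>) (q, p) (partial_p i) (partial_p j) =
           G_pp A c lam (g \<kappa>) q p i j"
    and "\<And>\<kappa> q p i j. \<kappa> \<in> atl \<Longrightarrow> q \<in> coord_image \<kappa> \<Longrightarrow>
           G (cotangent_chart atl \<kappa>) (q, p) (partial_p i) (delta_q (g \<kappa>) q p j) = 0"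
  shows "(c \<noteq> 0 \<longrightarrow>
            \<not> (\<exists>k. constant_holomorphic_sectional_curvature (cotangent_atlas atl) G J k))
         \<and> \<not> (\<exists>k. k \<noteq> 0 \<and>
               constant_holomorphic_sectional_curvature (cotangent_atlas atl) G J k)"
proof -
  note M = assms(1)
  obtain x \<kappa> where \<kappa>: "\<kappa> \<in> atl" and x: "x \<in> fst \<kappa>"
    using assms(1,2) unfolding smooth_manifold_def by blast
  define q where "q = snd \<kappa> x"
  have q: "q \<in> coord_image \<kappa>" using x by (simp add: q_def coord_image_def)
  have o: "open (coord_image \<kappa>)" using M \<kappa> by (simp add: smooth_manifold_def)
  let ?\<tau> = "cotangent_chart atl \<kappa>"
  have \<tau>: "?\<tau> \<in> cotangent_atlas atl" using \<kappa> by (simp add: cotangent_atlas_def)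
  have ci: "coord_image ?\<tau> = coord_image \<kappa> \<times> UNIV"
    by (rule coord_image_cotangent_chart[OF M \<kappa>])
  interpret base: riemannian_chart "coord_image \<kappa>" "g \<kappa>"
    by (rule riemannian_metric_imp_chart[OF assms(4) \<kappa> o])
  interpret total: kaehler_chart "coord_image \<kappa> \<times> UNIV" "G ?\<tau>" "J ?\<tau>"
    using kaehler_structure_imp_chart[OF assms(11) \<tau>] o by (simp add: ci open_Times)
  have "C_k_on 0 {0..} lam" using assms(6) by (simp only: smooth_on_def)
  then interpret cotangent_kaehler "coord_image \<kappa>" "g \<kappa>" "G ?\<tau>" A c lam "J ?\<tau>"
    using assms(7,8,12,14,15,16) \<kappa> by unfold_locales auto
  have "k = 0" "c = 0" if "constant_holomorphic_sectional_curvature (cotangent_atlas atl) G J k" for k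
  proof -
    have H: "sectional_curvature (G ?\<tau>) (q, 0) X (J ?\<tau> (q, 0) X) = k" if "X \<noteq> 0" for X
    proof -
      have "(q, 0) \<in> coord_image ?\<tau>" using q by (simp add: ci)
      then show ?thesis
        using \<open>constant_holomorphic_sectional_curvature (cotangent_atlas atl) G J k\<close> \<tau> that
        unfolding constant_holomorphic_sectional_curvature_def by blast
    qed
    show "k = 0" "c = 0" using constant_holomorphic_imp_zero[OF q assms(3) H] by auto
  qed
  then show ?thesis by blast
qed

end
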